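(* Let $\mathbb{K}$ be a field, let $\mathcal{P}$ be a stack polyomino on $[m]\times[n]$, and let $v=(i,j)\in V(\mathcal{P})$ be the vertex such that (1) $x_{i1}$ is the smallest variable of $S=\mathbb{K}[x_{kl} : (k,l)\in V(\mathcal{P})]$ with respect to the total order on variables given in the context, and (2) $j=\operatorname{height}(i)$. Let $\mathcal{P}_1$ and $\mathcal{P}_2$ be the following polyominoes: (1) if $i=1$, $\mathcal{P}_1$ is obtained from $\mathcal{P}$ by deleting the cell which contains the vertex $v$; otherwise, $\mathcal{P}_1$ is obtained from $\mathcal{P}$ by deleting the cell which contains the vertex $(m,\operatorname{height}(m))$; (2) $\mathcal{P}_2$ is obtained from $\mathcal{P}$ by deleting all the cells of $\mathcal{P}$ which lie below the horizontal edge interval containing the vertex $v$. Then $$e(\mathbb{K}[\mathcal{P}])=e(\mathbb{K}[\mathcal{P}_1])+e(\mathbb{K}[\mathcal{P}_2]).$$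
   Context: Polyominoes. A cell in $\mathbb{N}^2$ is a unit square $C=[a,a+(1,1)]$ with lower left corner $a\in\mathbb{N}^2$; its vertices are $a,\ a+(1,0),\ a+(0,1),\ a+(1,1)$ and its edges are its four sides. For a finite collection $\mathcal{P}$ of cells, $V(\mathcal{P})$ is the union of the vertex sets of its cells. A polyomino is a finite collection $\mathcal{P}$ of cells such that any two cells $A,B\in\mathcal{P}$ are connected by a sequence $A=A_1,\dots,A_r=B$ of cells of $\mathcal{P}$ with $A_i\cap A_{i+1}$ an edge of both $A_i$ and $A_{i+1}$. It is row (column) convex if, for any two cells of $\mathcal{P}$ in the same horizontal row (vertical column) of cells, all cells of that row (column) lying between them belong to $\mathcal{P}$; it is convex if it is both row and column convex. It is "on $[m]\times[n]$", where $[k]=\{1,\dots,k\}$, if $[(1,1),(m,n)]$ is the smallest interval of $\mathbb{N}^2$ (for the componentwise order) containing $V(\mathcal{P})$. A stack polyomino on $[m]\times[n]$ is a (nonempty) convex polyomino on $[m]\times[n]$ such that for every $i\in[m-1]$ the cell $[(i,1),(i+1,2)]$ belongs to $\mathcal{P}$. Height and order of variables. For $i\in[m]$, $\operatorname{height}(i)=\max\{j\in[n] : (i,j)\in V(\mathcal{P})\}$. The variables $x_{ij}$, $(i,j)\in V(\mathcal{P})$, are totally ordered by: $x_{ij}>x_{kl}$ if and only if $\operatorname{height}(i)>\operatorname{height}(k)$, or ($\operatorname{height}(i)=\operatorname{height}(k)$ and $i>k$), or ($i=k$ and $j>l$). The cells of $\mathcal{P}$ lying below the horizontal edge interval containing $v=(i,j)$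 are those with lower left corner $(r,s)$, $s<j$ (i.e. contained in the half plane below the horizontal line at height $j$). Coordinate ring and multiplicity. For a collection of cells $\mathcal{P}$ let $S=\mathbb{K}[x_{ij} : (i,j)\in V(\mathcal{P})]$, standard graded, let $I_{\mathcal{P}}\subset S$ be the ideal generated by all binomials $x_{il}x_{kj}-x_{ij}x_{kl}$ with $i<k$, $j<l$ such that all cells with lower left corner $(r,s)$, $i\le r<k$, $j\le s<l$, belong to $\mathcal{P}$, and let $\mathbb{K}[\mathcal{P}]=S/I_{\mathcal{P}}$. Write its Hilbert series as $H_{\mathbb{K}[\mathcal{P}]}(t)=Q(t)/(1-t)^d$ with $Q(t)\in\mathbb{Z}[t]$ and $d$ the Krull dimension of $\mathbb{K}[\mathcal{P}]$; the multiplicity is $e(\mathbb{K}[\mathcal{P}])=Q(1)$. If $\mathcal{P}_1$ or $\mathcal{P}_2$ is the empty collection, then its coordinate ring is $\mathbb{K}$, of multiplicity $1$. *)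

theory Defs
  imports
    "HOL-Algebra.QuotRing"
    "HOL-Algebra.Embedded_Algebras"
    "HOL-Library.Poly_Mapping"
    "HOL-Library.Extended_Nat"
    "HOL-Computational_Algebra.Polynomial_FPS"
begin

section \<open>Polyominoes\<close>

text \<open>A cell is represented by its lower left corner.\<close>

type_synonym vertex = "nat \<times> nat"
type_synonym cell = "nat \<times> nat"

definition cell_vertices :: "cell \<Rightarrow> vertex set" where
  "cell_vertices C = (case C of (a, b) \<Rightarrow> {(a, b), (a + 1, b), (a, b + 1), (a + 1, b + 1)})"

text \<open>An edge is represented by the set of its two end points.\<close>

definition cell_edges :: "cell \<Rightarrow> vertex set set" where
  "cell_edges C = (case C of (a, b) \<Rightarrow>
     {{(a, b), (a + 1, b)}, {(a, b + 1), (a + 1, b + 1)},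
      {(a, b), (a, b + 1)}, {(a + 1, b), (a + 1, b + 1)}})"

definition vertices :: "cell set \<Rightarrow> vertex set" where
  "vertices P = (\<Union>C\<in>P. cell_vertices C)"

definition share_edge :: "cell \<Rightarrow> cell \<Rightarrow> bool" where
  "share_edge A B \<longleftrightarrow> cell_vertices A \<inter> cell_vertices B \<in> cell_edges A \<inter> cell_edges B"

definition polyomino :: "cell set \<Rightarrow> bool" where
  "polyomino P \<longleftrightarrow> finite P \<and>
     (\<forall>A\<in>P. \<forall>B\<in>P. \<exists>As. As \<noteq> [] \<and> hd As = A \<and> last As = B \<and> set As \<subseteq> P \<and>
        successively share_edge As)"

definition row_convex :: "cell set \<Rightarrow> bool" where
  "row_convex P \<longleftrightarrow>
     (\<forall>a b c s. (a, s) \<in> P \<longrightarrow> (b, s) \<in> P \<longrightarrow> a \<le> c \<longrightarrow> c \<le> b \<longrightarrow> (c, s) \<in> P)"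

definition column_convex :: "cell set \<Rightarrow> bool" where
  "column_convex P \<longleftrightarrow>
     (\<forall>r a b c. (r, a) \<in> P \<longrightarrow> (r, b) \<in> P \<longrightarrow> a \<le> c \<longrightarrow> c \<le> b \<longrightarrow> (r, c) \<in> P)"

definition convex_polyomino :: "cell set \<Rightarrow> bool" where
  "convex_polyomino P \<longleftrightarrow> polyomino P \<and> row_convex P \<and> column_convex P"

text \<open>The interval from \<open>(a, b)\<close> to \<open>(c, d)\<close> for the componentwise order on pairs is
  \<open>{a..c} \<times> {b..d}\<close>.\<close>

definition on_grid :: "nat \<Rightarrow> nat \<Rightarrow> cell set \<Rightarrow> bool" where
  "on_grid m n P \<longleftrightarrow> vertices P \<subseteq> {1..m} \<times> {1..n} \<and>
     (\<forall>a b c d. vertices P \<subseteq> {a..c} \<times> {b..d} \<longrightarrow> {1..m} \<times> {1..n} \<subseteq> {a..c} \<times> {b..d})"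

definition stack_polyomino :: "nat \<Rightarrow> nat \<Rightarrow> cell set \<Rightarrow> bool" where
  "stack_polyomino m n P \<longleftrightarrow> P \<noteq> {} \<and> convex_polyomino P \<and> on_grid m n P \<and>
     (\<forall>i\<in>{1..m-1}. (i, 1) \<in> P)"

definition height :: "cell set \<Rightarrow> nat \<Rightarrow> nat" where
  "height P i = Max {j. (i, j) \<in> vertices P}"

text \<open>The variable at a vertex \<open>(i, j)\<close> is identified with \<open>(i, j)\<close>.\<close>

definition var_greater :: "cell set \<Rightarrow> vertex \<Rightarrow> vertex \<Rightarrow> bool" where
  "var_greater P v w = (case (v, w) of ((i, j), (k, l)) \<Rightarrow>
     height P i > height P k \<or> (height P i = height P k \<and> i > k) \<or> (i = k \<and> j > l))"

definition smallest_variable :: "cell set \<Rightarrow> vertex \<Rightarrow> bool" where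
  "smallest_variable P v \<longleftrightarrow>
     v \<in> vertices P \<and> (\<forall>w\<in>vertices P. w \<noteq> v \<longrightarrow> var_greater P w v)"

text \<open>At the vertices \<open>(1, height P 1)\<close> and \<open>(m, height P m)\<close> of a stack polyomino on
  \<open>[m] \<times> [n]\<close> exactly one cell is deleted, as each is a vertex of only one cell of \<open>P\<close>.\<close>

definition delete_cells_at :: "vertex \<Rightarrow> cell set \<Rightarrow> cell set" where
  "delete_cells_at v P = P - {C \<in> P. v \<in> cell_vertices C}"

definition delete_cells_below :: "nat \<Rightarrow> cell set \<Rightarrow> cell set" where
  "delete_cells_below j P = P - {C \<in> P. snd C < j}"


section \<open>The coordinate ring\<close>

text \<open>Monomials are finitely supported exponent functions, and polynomials are finitely
  supported coefficient functions on monomials, with the library's convolution product.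
  The type has one variable for every point of \<open>nat \<times> nat\<close>; \<open>poly_ring V\<close> is the
  polynomial ring in the variables from \<open>V\<close> only.\<close>

type_synonym monomial = "vertex \<Rightarrow>\<^sub>0 nat"
type_synonym 'k mpoly = "monomial \<Rightarrow>\<^sub>0 'k"

definition var :: "vertex \<Rightarrow> 'k::field mpoly" where
  "var v = Poly_Mapping.single (Poly_Mapping.single v 1) 1"

definition const :: "'k::field \<Rightarrow> 'k mpoly" where
  "const c = Poly_Mapping.single 0 c"

definition poly_ring :: "vertex set \<Rightarrow> 'k::field mpoly ring" where
  "poly_ring V =
     \<lparr>carrier = {p. \<forall>t\<in>Poly_Mapping.keys p. Poly_Mapping.keys t \<subseteq> V},
      monoid.mult = (*), one = 1, zero = 0, add = (+)\<rparr>"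

definition mon_degree :: "monomial \<Rightarrow> nat" where
  "mon_degree t = (\<Sum>v\<in>Poly_Mapping.keys t. Poly_Mapping.lookup t v)"

definition poly_component :: "vertex set \<Rightarrow> nat \<Rightarrow> 'k::field mpoly set" where
  "poly_component V d =
     {p \<in> carrier (poly_ring V). \<forall>t\<in>Poly_Mapping.keys p. mon_degree t = d}"

definition inner_binomials :: "cell set \<Rightarrow> 'k::field mpoly set" where
  "inner_binomials P =
     {var (i, l) * var (k, j) - var (i, j) * var (k, l) | i j k l.
        i < k \<and> j < l \<and> (\<forall>r s. i \<le> r \<and> r < k \<and> j \<le> s \<and> s < l \<longrightarrow> (r, s) \<in> P)}"

definition polyomino_ideal :: "cell set \<Rightarrow> 'k::field mpoly set" where
  "polyomino_ideal P = Idl\<^bsub>poly_ring (vertices P)\<^esub> (inner_binomials P)"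

definition coord_ring :: "cell set \<Rightarrow> 'k::field mpoly set ring" where
  "coord_ring P = poly_ring (vertices P) Quot polyomino_ideal P"

definition residue_class :: "cell set \<Rightarrow> 'k::field mpoly \<Rightarrow> 'k mpoly set" where
  "residue_class P p = polyomino_ideal P +>\<^bsub>poly_ring (vertices P)\<^esub> p"

text \<open>The copy of the ground field in the coordinate ring, and the graded components.\<close>

definition coord_scalars :: "cell set \<Rightarrow> 'k::field mpoly set set" where
  "coord_scalars P = residue_class P ` range const"

definition coord_component :: "cell set \<Rightarrow> nat \<Rightarrow> 'k::field mpoly set set" where
  "coord_component P d = residue_class P ` poly_component (vertices P) d"


section \<open>Multiplicity\<close>

definition krull_dim :: "('a, 'b) ring_scheme \<Rightarrow> enat" where
  "krull_dim R = Sup {enat n | n. \<exists>\<pp>::nat \<Rightarrow> 'a set.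
     (\<forall>i\<le>n. primeideal (\<pp> i) R) \<and> (\<forall>i<n. \<pp> i \<subset> \<pp> (Suc i))}"

text \<open>In the next two definitions \<open>R\<close> is a graded algebra over its subfield \<open>K\<close>, with component
  \<open>G d\<close> of degree \<open>d\<close>.\<close>

definition hilbert_series ::
    "('a, 'b) ring_scheme \<Rightarrow> 'a set \<Rightarrow> (nat \<Rightarrow> 'a set) \<Rightarrow> int fps" where
  "hilbert_series R K G = Abs_fps (\<lambda>d. int (ring.dim R K (G d)))"

text \<open>The equation \<open>H(t) = Q(t) / (1 - t)^d\<close> is stated with the denominator cleared.
  It determines \<open>Q\<close> uniquely.\<close>

definition graded_multiplicity ::
    "('a, 'b) ring_scheme \<Rightarrow> 'a set \<Rightarrow> (nat \<Rightarrow> 'a set) \<Rightarrow> int" where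
  "graded_multiplicity R K G =
     (THE e. \<exists>Q :: int poly.
        hilbert_series R K G * (1 - fps_X) ^ the_enat (krull_dim R) = fps_of_poly Q \<and>
        e = poly Q 1)"

definition multiplicity_over :: "'k::field itself \<Rightarrow> cell set \<Rightarrow> int" where
  "multiplicity_over k P =
     graded_multiplicity (coord_ring P :: 'k mpoly set ring) (coord_scalars P) (coord_component P)"

end

theory Submission
  imports Defs
begin

text \<open>
  After the columns of a stack polyomino are sorted by height, its vertices form a Ferrers shape:
  a column that comes later contains every row that an earlier one reaches. The inner binomials are
  then, up to sign, exactly the \<open>2\<close>-minors \<open>x(i,l) x(k,j) - x(i,j) x(k,l)\<close> whose four corners are
  vertices. Fix an order \<open>\<kappa>\<close> on the columns along which the heights increase weakly. Whenever
  column \<open>i\<close> precedes column \<open>k\<close> and \<open>j < l\<close>, the first term of the minor can be replaced by the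
  second; this ends with a monomial supported on a chain, that is, a set of vertices whose row
  index grows weakly along \<open>\<kappa>\<close>. The toric map \<open>x(i,j) \<mapsto> s(i) t(j)\<close> kills the ideal, and a chain
  monomial can be recovered from its image. So the chain monomials are a basis of the coordinate
  ring, and its Hilbert series \<open>F(V)\<close> counts them (\<open>hilbert_series_eq\<close>).

  The recursion is visible on chains. Let \<open>v = (c, j)\<close> be the top vertex of the first (hence
  shortest) column. A chain monomial either avoids \<open>v\<close>, or is \<open>v\<close> times a chain monomial in the
  vertices comparable with \<open>v\<close>. Those are the vertices of column \<open>c\<close>, which are comparable with all
  of them and so behave as free variables, and the vertices \<open>W\<close> of the other columns
  in rows at least \<open>j\<close>. If the base row is \<open>b\<close>, this gives
  \<open>F(V) = F(V - {v}) + t / (1 - t)^(j + 1 - b) F(W)\<close>. The dimensions \<open>#columns + #rows - 1\<close> of the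
  three shapes match the powers of \<open>1 - t\<close>, so the numerators at \<open>t = 1\<close> simply add
  (\<open>has_mult_corner\<close>). Up to free variables, which do not change a multiplicity, \<open>V - {v}\<close> and \<open>W\<close>
  are the vertex sets of the two smaller polyominoes.

  For this to be a statement about multiplicities, \<open>#columns + #rows - 1\<close> must be the Krull
  dimension (\<open>krull_dim_eq\<close>). Setting the variables \<open>t(j)\<close>, \<open>s(i)\<close> of the toric map to zero one at a
  time gives a chain of primes of that length. Conversely, elements \<open>f\<^sub>k\<close> in the successive
  differences of a chain of primes are algebraically independent, so a chain of length \<open>n\<close>
  forces the number of chain monomials of degree at most \<open>M\<close> to grow at least like \<open>M^n\<close>, while
  the Hilbert series bounds that growth.

  The column order that serves all three polyominoes at once puts an extremal column (the first
  or the last) in front and sorts the remaining ones by height.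
\<close>

section \<open>Monomials\<close>

lemma keys_add_nat: "Poly_Mapping.keys (s + t) = Poly_Mapping.keys s \<union> Poly_Mapping.keys t"
  for s t :: "'a \<Rightarrow>\<^sub>0 nat"
  by (auto simp: in_keys_iff lookup_add)

lemma mon_degree_zero [simp]: "mon_degree 0 = 0"
  by (simp add: mon_degree_def)

lemma mon_degree_add: "mon_degree (s + t) = mon_degree s + mon_degree t"
  unfolding mon_degree_def by (rule setsum_keys_plus_distrib) auto

lemma mon_degree_single [simp]: "mon_degree (Poly_Mapping.single v n) = n"
  by (simp add: mon_degree_def)

lemma mon_degree_eq_0_iff: "mon_degree t = 0 \<longleftrightarrow> t = 0"
proof
  assume "mon_degree t = 0"
  then have "\<forall>v\<in>Poly_Mapping.keys t. Poly_Mapping.lookup t v = 0"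
    by (simp add: mon_degree_def)
  then show "t = 0"
    by (intro poly_mapping_eqI) (auto simp: in_keys_iff)
qed simp

lemma monomial_split_var:
  fixes t :: "'a \<Rightarrow>\<^sub>0 nat"
  assumes "v \<in> Poly_Mapping.keys t"
  obtains u where "t = u + Poly_Mapping.single v 1"
proof
  show "t = (t - Poly_Mapping.single v 1) + Poly_Mapping.single v 1"
    using assms by (intro poly_mapping_eqI)
      (auto simp: lookup_add lookup_minus lookup_single when_def in_keys_iff)
qed

lemma monomial_split_two_vars:
  fixes t :: "'a \<Rightarrow>\<^sub>0 nat"
  assumes "v \<in> Poly_Mapping.keys t" "w \<in> Poly_Mapping.keys t" "v \<noteq> w"
  obtains u where "t = u + Poly_Mapping.single v 1 + Poly_Mapping.single w 1"
proof -
  obtain u where u: "t = u + Poly_Mapping.single w 1"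
    using monomial_split_var[OF assms(2)] .
  have "v \<in> Poly_Mapping.keys u"
    using assms(1,3) unfolding u by (simp add: keys_add_nat)
  then show ?thesis
    using u that by (metis monomial_split_var)
qed

lemma finite_monomials_of_degree:
  assumes "finite V"
  shows "finite {t :: monomial. Poly_Mapping.keys t \<subseteq> V \<and> mon_degree t = d}"
proof (induction d)
  case 0
  show ?case
    by (rule finite_subset[of _ "{0}"]) (auto simp: mon_degree_eq_0_iff)
next
  case (Suc d)
  let ?M = "\<lambda>d. {t :: monomial. Poly_Mapping.keys t \<subseteq> V \<and> mon_degree t = d}"
  have "?M (Suc d) \<subseteq> (\<Union>v\<in>V. (\<lambda>u. u + Poly_Mapping.single v 1) ` ?M d)"
  proof
    fix t assume t: "t \<in> ?M (Suc d)"
    then have "t \<noteq> 0" by auto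
    then obtain v where v: "v \<in> Poly_Mapping.keys t" by (metis all_not_in_conv keys_eq_empty)
    then obtain u where u: "t = u + Poly_Mapping.single v 1" by (rule monomial_split_var)
    have "u \<in> ?M d"
      using t unfolding u by (simp add: keys_add_nat mon_degree_add)
    then show "t \<in> (\<Union>v\<in>V. (\<lambda>u. u + Poly_Mapping.single v 1) ` ?M d)"
      using t v u by blast
  qed
  then show ?case
    by (rule finite_subset) (use assms Suc in auto)
qed

section \<open>Chain monomials and their generating function\<close>

text \<open>Row indices have to grow weakly with the column order \<open>\<kappa>\<close>; two vertices of the same column are
always comparable. The incomparable pairs are exactly the ones that a binomial of the ideal
allows to rewrite.\<close>

definition comparable :: "(nat \<Rightarrow> nat) \<Rightarrow> vertex \<Rightarrow> vertex \<Rightarrow> bool" where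
  "comparable \<kappa> v w \<longleftrightarrow>
     (\<kappa> (fst v) < \<kappa> (fst w) \<longrightarrow> snd v \<le> snd w) \<and> (\<kappa> (fst w) < \<kappa> (fst v) \<longrightarrow> snd w \<le> snd v)"

definition is_chain :: "(nat \<Rightarrow> nat) \<Rightarrow> vertex set \<Rightarrow> bool" where
  "is_chain \<kappa> S \<longleftrightarrow> (\<forall>v\<in>S. \<forall>w\<in>S. comparable \<kappa> v w)"

definition chain_monomials :: "(nat \<Rightarrow> nat) \<Rightarrow> vertex set \<Rightarrow> nat \<Rightarrow> monomial set" where
  "chain_monomials \<kappa> V d =
     {t. Poly_Mapping.keys t \<subseteq> V \<and> mon_degree t = d \<and> is_chain \<kappa> (Poly_Mapping.keys t)}"

definition chain_series :: "(nat \<Rightarrow> nat) \<Rightarrow> vertex set \<Rightarrow> int fps" where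
  "chain_series \<kappa> V = Abs_fps (\<lambda>d. int (card (chain_monomials \<kappa> V d)))"

lemma comparable_refl [simp]: "comparable \<kappa> v v"
  by (simp add: comparable_def)

lemma comparable_sym: "comparable \<kappa> v w \<longleftrightarrow> comparable \<kappa> w v"
  by (auto simp: comparable_def)

lemma finite_chain_monomials [simp]: "finite V \<Longrightarrow> finite (chain_monomials \<kappa> V d)"
  by (rule finite_subset[OF _ finite_monomials_of_degree[of V d]]) (auto simp: chain_monomials_def)

lemma chain_monomials_0: "chain_monomials \<kappa> V 0 = {0}"
  by (auto simp: chain_monomials_def mon_degree_eq_0_iff is_chain_def)

text \<open>A chain through \<open>v\<close> stays among the vertices comparable with \<open>v\<close>, and multiplying a chain
monomial in those by \<open>v\<close> keeps its support a chain.\<close>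

lemma chain_monomials_Suc:
  assumes "v \<in> V"
  shows "chain_monomials \<kappa> V (Suc d) =
    chain_monomials \<kappa> (V - {v}) (Suc d) \<union>
    (\<lambda>u. u + Poly_Mapping.single v 1) ` chain_monomials \<kappa> {w\<in>V. comparable \<kappa> v w} d"
    (is "_ = ?A \<union> ?B")
proof
  show "chain_monomials \<kappa> V (Suc d) \<subseteq> ?A \<union> ?B"
  proof
    fix t assume t: "t \<in> chain_monomials \<kappa> V (Suc d)"
    show "t \<in> ?A \<union> ?B"
    proof (cases "v \<in> Poly_Mapping.keys t")
      case True
      then obtain u where u: "t = u + Poly_Mapping.single v 1" by (rule monomial_split_var)
      have "u \<in> chain_monomials \<kappa> {w\<in>V. comparable \<kappa> v w} d"
        using t unfolding u chain_monomials_def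
        by (auto simp: keys_add_nat mon_degree_add is_chain_def)
      then show ?thesis using u by blast
    qed (use t in \<open>auto simp: chain_monomials_def\<close>)
  qed
  show "?A \<union> ?B \<subseteq> chain_monomials \<kappa> V (Suc d)"
  proof
    fix t assume "t \<in> ?A \<union> ?B"
    then consider "t \<in> ?A"
      | u where "t = u + Poly_Mapping.single v 1" "u \<in> chain_monomials \<kappa> {w\<in>V. comparable \<kappa> v w} d"
      by blast
    then show "t \<in> chain_monomials \<kappa> V (Suc d)"
    proof cases
      case 1
      then show ?thesis by (auto simp: chain_monomials_def)
    next
      case 2
      then have "comparable \<kappa> v w" "comparable \<kappa> w v" if "w \<in> Poly_Mapping.keys u" for w
        using that comparable_sym[of \<kappa> v w] by (auto simp: chain_monomials_def)
      then show ?thesis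
        using 2 assms by (auto simp: chain_monomials_def keys_add_nat mon_degree_add is_chain_def)
    qed
  qed
qed

lemma chain_series_remove:
  assumes "finite V" "v \<in> V"
  shows "chain_series \<kappa> V =
    chain_series \<kappa> (V - {v}) + fps_X * chain_series \<kappa> {w\<in>V. comparable \<kappa> v w}"
proof (rule fps_ext)
  fix d
  show "fps_nth (chain_series \<kappa> V) d =
    fps_nth (chain_series \<kappa> (V - {v}) + fps_X * chain_series \<kappa> {w\<in>V. comparable \<kappa> v w}) d"
  proof (cases d)
    case 0
    then show ?thesis by (simp add: chain_series_def chain_monomials_0)
  next
    case (Suc e)
    let ?A = "chain_monomials \<kappa> (V - {v}) (Suc e)"
    let ?C = "chain_monomials \<kappa> {w\<in>V. comparable \<kappa> v w} e"
    have "card (chain_monomials \<kappa> V d) = card ?A + card ((\<lambda>u. u + Poly_Mapping.single v 1) ` ?C)"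
      unfolding Suc chain_monomials_Suc[OF assms(2)]
    proof (rule card_Un_disjoint)
      show "?A \<inter> (\<lambda>u. u + Poly_Mapping.single v 1) ` ?C = {}"
        by (auto simp: chain_monomials_def keys_add_nat)
    qed (use assms in auto)
    also have "card ((\<lambda>u. u + Poly_Mapping.single v 1) ` ?C) = card ?C"
      by (intro card_image inj_onI) simp
    finally show ?thesis
      using Suc by (simp add: chain_series_def)
  qed
qed

lemma chain_series_empty [simp]: "chain_series \<kappa> {} = 1"
proof (rule fps_ext)
  fix d
  have "chain_monomials \<kappa> {} d = (if d = 0 then {0} else {})"
    by (auto simp: chain_monomials_def is_chain_def)
  then show "fps_nth (chain_series \<kappa> {}) d = fps_nth 1 d"
    by (simp add: chain_series_def)
qed

text \<open>A vertex comparable with all vertices is a free variable: it occurs with any exponent, which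
contributes a geometric series.\<close>

lemma chain_series_remove_free:
  assumes "finite V" "v \<in> V" "\<And>w. w \<in> V \<Longrightarrow> comparable \<kappa> v w"
  shows "chain_series \<kappa> V * (1 - fps_X) = chain_series \<kappa> (V - {v})"
proof -
  have "{w\<in>V. comparable \<kappa> v w} = V" using assms(3) by blast
  then have "chain_series \<kappa> V = chain_series \<kappa> (V - {v}) + fps_X * chain_series \<kappa> V"
    using chain_series_remove[OF assms(1,2), of \<kappa>] by simp
  then show ?thesis by (simp add: algebra_simps)
qed

lemma chain_series_remove_free_set:
  assumes "finite B" "finite V" "B \<subseteq> V" "\<And>v w. v \<in> B \<Longrightarrow> w \<in> V \<Longrightarrow> comparable \<kappa> v w"
  shows "chain_series \<kappa> V * (1 - fps_X) ^ card B = chain_series \<kappa> (V - B)"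
  using assms
proof (induction B rule: finite_induct)
  case (insert v B)
  have "chain_series \<kappa> V * (1 - fps_X) ^ card (insert v B) = chain_series \<kappa> (V - B) * (1 - fps_X)"
    using insert by (simp add: mult.assoc mult.commute)
  also have "\<dots> = chain_series \<kappa> (V - B - {v})"
    by (rule chain_series_remove_free) (use insert in auto)
  also have "V - B - {v} = V - insert v B" by auto
  finally show ?case .
qed simp

section \<open>Multiplicities of Ferrers shapes\<close>

text \<open>A Ferrers shape with base row \<open>b\<close>, up to a permutation of its columns. Sorting them by a key \<open>\<kappa>\<close>
instead of renaming them lets the column indices keep their geometric meaning.\<close>

definition ferrers :: "(nat \<Rightarrow> nat) \<Rightarrow> nat \<Rightarrow> vertex set \<Rightarrow> bool" where
  "ferrers \<kappa> b V \<longleftrightarrow> finite V \<and> inj_on \<kappa> (fst ` V) \<and>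
     (\<forall>i j. (i, j) \<in> V \<longrightarrow> b \<le> j \<and> (\<forall>j'. b \<le> j' \<longrightarrow> j' \<le> j \<longrightarrow> (i, j') \<in> V) \<and>
        (\<forall>k\<in>fst ` V. \<kappa> i < \<kappa> k \<longrightarrow> (k, j) \<in> V))"

text \<open>The dimension of the toric ring of a nonempty shape: the rank of the incidence matrix of the
connected bipartite graph that has rows and columns as its nodes and the vertices of the shape as
its edges. Truncated subtraction makes the empty shape have dimension \<open>0\<close>.\<close>

definition shape_dim :: "vertex set \<Rightarrow> nat" where
  "shape_dim V = card (fst ` V) + card (snd ` V) - 1"

text \<open>The combinatorial counterpart of the multiplicity, with \<open>shape_dim\<close> in place of the Krull
dimension and the chain series in place of the Hilbert series.\<close>

definition has_mult :: "(nat \<Rightarrow> nat) \<Rightarrow> vertex set \<Rightarrow> int \<Rightarrow> bool" where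
  "has_mult \<kappa> V e \<longleftrightarrow>
     (\<exists>Q. chain_series \<kappa> V * (1 - fps_X) ^ shape_dim V = fps_of_poly Q \<and> e = poly Q 1)"

lemma ferrersD:
  assumes "ferrers \<kappa> b V"
  shows "finite V" "inj_on \<kappa> (fst ` V)" "\<And>i j. (i, j) \<in> V \<Longrightarrow> b \<le> j"
    "\<And>i j j'. (i, j) \<in> V \<Longrightarrow> b \<le> j' \<Longrightarrow> j' \<le> j \<Longrightarrow> (i, j') \<in> V"
    "\<And>i j k. (i, j) \<in> V \<Longrightarrow> k \<in> fst ` V \<Longrightarrow> \<kappa> i < \<kappa> k \<Longrightarrow> (k, j) \<in> V"
  using assms unfolding ferrers_def by blast+

lemma ferrersI:
  assumes "finite V" "inj_on \<kappa> (fst ` V)" "\<And>i j. (i, j) \<in> V \<Longrightarrow> b \<le> j"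
    "\<And>i j j'. (i, j) \<in> V \<Longrightarrow> b \<le> j' \<Longrightarrow> j' \<le> j \<Longrightarrow> (i, j') \<in> V"
    "\<And>i j k l. (i, j) \<in> V \<Longrightarrow> (k, l) \<in> V \<Longrightarrow> \<kappa> i < \<kappa> k \<Longrightarrow> (k, j) \<in> V"
  shows "ferrers \<kappa> b V"
  unfolding ferrers_def
proof (intro conjI allI impI ballI)
  fix i j k assume ij: "(i, j) \<in> V" and k: "k \<in> fst ` V" and less: "\<kappa> i < \<kappa> k"
  from k obtain l where "(k, l) \<in> V" by force
  then show "(k, j) \<in> V" by (rule assms(5)[OF ij _ less])
qed (fact assms(1,2,3) | rule assms(4); assumption)+

lemma has_mult_unique: "has_mult \<kappa> V e \<Longrightarrow> has_mult \<kappa> V e' \<Longrightarrow> e = e'"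
  by (auto simp: has_mult_def)

lemma shape_dim_empty [simp]: "shape_dim {} = 0"
  by (simp add: shape_dim_def)

lemma has_mult_empty: "has_mult \<kappa> {} 1"
  unfolding has_mult_def by (rule exI[of _ 1]) simp

text \<open>Each free variable raises the dimension by one and divides the series by \<open>1 - t\<close>, so the numerator
stays the same.\<close>

lemma has_mult_remove_free_set:
  assumes "has_mult \<kappa> (V - B) e" "finite V" "B \<subseteq> V"
    "\<And>v w. v \<in> B \<Longrightarrow> w \<in> V \<Longrightarrow> comparable \<kappa> v w"
    "shape_dim V = card B + shape_dim (V - B)"
  shows "has_mult \<kappa> V e"
proof -
  have "finite B" using assms(2,3) finite_subset by blast
  then have "chain_series \<kappa> V * (1 - fps_X) ^ card B = chain_series \<kappa> (V - B)"
    by (rule chain_series_remove_free_set) (use assms in auto)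
  then have "chain_series \<kappa> V * (1 - fps_X) ^ shape_dim V
      = chain_series \<kappa> (V - B) * (1 - fps_X) ^ shape_dim (V - B)"
    unfolding assms(5) power_add by (simp add: mult.assoc [symmetric])
  then show ?thesis
    using assms(1) by (simp add: has_mult_def)
qed

lemma has_mult_remove_free:
  assumes "has_mult \<kappa> (V - {v}) e" "finite V" "v \<in> V"
    "\<And>w. w \<in> V \<Longrightarrow> comparable \<kappa> v w" "shape_dim V = Suc (shape_dim (V - {v}))"
  shows "has_mult \<kappa> V e"
  by (rule has_mult_remove_free_set[of _ _ "{v}"]) (use assms in auto)

text \<open>The only vertex of a column of height one is free: every column that precedes it is
equally low.\<close>

lemma has_mult_remove_low_columns:
  assumes V: "ferrers \<kappa> b V"
    and e: "has_mult \<kappa> {v \<in> V. (fst v, Suc b) \<in> V} e"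
  shows "has_mult \<kappa> V e"
proof -
  define B where "B = {v \<in> V. (fst v, Suc b) \<notin> V}"
  note f = ferrersD[OF V]
  have B_snd: "snd v = b" if "v \<in> B" for v
  proof -
    have "(fst v, snd v) \<in> V" "(fst v, Suc b) \<notin> V" using that by (auto simp: B_def)
    then have "\<not> Suc b \<le> snd v" "b \<le> snd v" using f(3)[of "fst v" "snd v"] f(4)[of "fst v" "snd v" "Suc b"] by auto
    then show ?thesis by simp
  qed
  have V_B: "V - B = {v \<in> V. (fst v, Suc b) \<in> V}" by (auto simp: B_def)
  have "has_mult \<kappa> (V - B) e" unfolding V_B by (rule e)
  then show ?thesis
  proof (rule has_mult_remove_free_set)
    show "finite V" by (rule f)
    show "B \<subseteq> V" by (auto simp: B_def)
    show "comparable \<kappa> v w" if "v \<in> B" "w \<in> V" for v w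
    proof -
      have w: "(fst w, snd w) \<in> V" and v: "fst v \<in> fst ` V" using that by (auto simp: B_def)
      have "snd w \<le> b" if "\<kappa> (fst w) < \<kappa> (fst v)"
      proof (rule ccontr)
        assume "\<not> snd w \<le> b"
        then have "(fst v, Suc b) \<in> V" using f(5)[OF w v that] f(4) by simp
        then show False using \<open>v \<in> B\<close> by (simp add: B_def)
      qed
      then show ?thesis
        using f(3)[OF w] B_snd[OF \<open>v \<in> B\<close>] unfolding comparable_def by simp
    qed
    have inj: "inj_on fst B" by (rule inj_onI) (simp add: prod_eq_iff B_snd)
    have fst_img: "fst ` (V - B) = fst ` V - fst ` B"
    proof -
      have ne: "fst v \<noteq> fst w" if "v \<in> V - B" "w \<in> B" for v w using that by (auto simp: B_def)
      show ?thesis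
      proof (intro equalityI subsetI)
        fix x assume "x \<in> fst ` (V - B)"
        then obtain v where v: "x = fst v" "v \<in> V - B" by (rule imageE)
        then have "x \<notin> fst ` B" using ne[OF v(2)] by (simp add: image_iff)
        then show "x \<in> fst ` V - fst ` B" using v by simp
      next
        fix x assume x: "x \<in> fst ` V - fst ` B"
        then obtain v where v: "x = fst v" "v \<in> V" by (elim DiffE imageE)
        then have "v \<in> V - B" using x imageI[of v B fst] by auto
        then show "x \<in> fst ` (V - B)" using v(1) by simp
      qed
    qed
    have "card (fst ` V) = card (fst ` B) + card (fst ` (V - B))"
    proof -
      have "finite (fst ` V)" "fst ` B \<subseteq> fst ` V" using f(1) by (auto simp: B_def)
      then show ?thesis
        unfolding fst_img by (metis card_Diff_subset card_mono finite_subset le_add_diff_inverse)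
    qed
    then have cardF: "card (fst ` V) = card B + card (fst ` (V - B))"
      by (simp add: card_image[OF inj])
    show "shape_dim V = card B + shape_dim (V - B)"
    proof (cases "V - B = {}")
      case True
      then have VB: "V = B" by (auto simp: B_def)
      show ?thesis
      proof (cases "B = {}")
        case False
        have "snd ` B = {b}"
          using B_snd False by (auto simp: image_iff)
        then show ?thesis
          using card_image[OF inj] VB by (simp add: shape_dim_def)
      qed (use VB in simp)
    next
      case False
      have "snd ` (V - B) = snd ` V"
      proof
        obtain v where v: "v \<in> V" "(fst v, Suc b) \<in> V" using False V_B by auto
        have "(fst v, b) \<in> V - B" unfolding V_B using v(2) f(4)[OF v(2), of b] by simp
        then have "b \<in> snd ` (V - B)" by (metis image_eqI snd_conv)
        then show "snd ` V \<subseteq> snd ` (V - B)"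
          using B_snd by (metis DiffI image_eqI image_subsetI)
      qed auto
      moreover have "card (fst ` (V - B)) > 0"
        using False f(1) by (simp add: card_gt_0_iff)
      ultimately show ?thesis
        using cardF by (simp add: shape_dim_def)
    qed
  qed
qed

text \<open>The corner \<open>(c, j)\<close> is the top vertex of the \<open>\<kappa>\<close>-first column, which is a shortest one.\<close>

locale ferrers_corner =
  fixes \<kappa> :: "nat \<Rightarrow> nat" and b :: nat and V :: "vertex set" and c j :: nat
  assumes ferrers: "ferrers \<kappa> b V"
    and corner: "(c, j) \<in> V" "(c, Suc j) \<notin> V"
    and first: "\<And>k. k \<in> fst ` V \<Longrightarrow> \<kappa> c \<le> \<kappa> k"
begin

definition upper_right :: "vertex set" where
  "upper_right = {v \<in> V. fst v \<noteq> c \<and> j \<le> snd v}"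

lemmas fin = ferrersD(1)[OF ferrers]
  and inj = ferrersD(2)[OF ferrers]
  and base = ferrersD(3)[OF ferrers]
  and down = ferrersD(4)[OF ferrers]
  and nested = ferrersD(5)[OF ferrers]

lemma base_le_corner: "b \<le> j"
  using base corner(1) .

lemma first_less: "k \<in> fst ` V \<Longrightarrow> k \<noteq> c \<Longrightarrow> \<kappa> c < \<kappa> k"
  using first[of k] inj corner(1) by (metis fst_conv imageI inj_on_def le_neq_implies_less)

lemma rectangle: "k \<in> fst ` V \<Longrightarrow> b \<le> l \<Longrightarrow> l \<le> j \<Longrightarrow> (k, l) \<in> V"
  using nested[OF corner(1), of k] first_less[of k] down corner(1) by metis

lemma corner_column: "(c, l) \<in> V \<longleftrightarrow> b \<le> l \<and> l \<le> j"
  using base[of c l] down[of c l "Suc j"] down[OF corner(1), of l] corner(2)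
  by (metis base_le_corner le_SucI not_less_eq_eq)

text \<open>Column \<open>c\<close> comes first, so comparability with \<open>(c, j)\<close> means lying in column \<open>c\<close> or in a row
not below \<open>j\<close>.\<close>

lemma comparable_corner:
  "{w \<in> V. comparable \<kappa> (c, j) w} = {c} \<times> {b..j} \<union> upper_right"
proof (rule Set.set_eqI)
  fix w :: vertex
  obtain k l where w: "w = (k, l)" by force
  show "w \<in> {w \<in> V. comparable \<kappa> (c, j) w} \<longleftrightarrow> w \<in> {c} \<times> {b..j} \<union> upper_right"
  proof (cases "k = c")
    case True
    then show ?thesis by (auto simp: w comparable_def corner_column upper_right_def)
  next
    case False
    then have "\<kappa> c < \<kappa> k" if "(k, l) \<in> V" using first_less[of k] that by force
    then show ?thesis using False by (auto simp: w comparable_def upper_right_def)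
  qed
qed

lemma chain_series_upper_right:
  "chain_series \<kappa> {w \<in> V. comparable \<kappa> (c, j) w} * (1 - fps_X) ^ (Suc j - b)
     = chain_series \<kappa> upper_right"
proof -
  let ?N = "{c} \<times> {b..j} \<union> upper_right"
  have "chain_series \<kappa> ?N * (1 - fps_X) ^ card ({c} \<times> {b..j}) = chain_series \<kappa> (?N - {c} \<times> {b..j})"
  proof (rule chain_series_remove_free_set)
    show "finite ?N" using fin by (simp add: upper_right_def)
    fix v w assume "v \<in> {c} \<times> {b..j}" "w \<in> ?N"
    moreover have "\<kappa> c < \<kappa> (fst w)" if "w \<in> upper_right"
      using that first_less by (auto simp: upper_right_def)
    ultimately show "comparable \<kappa> v w"
      by (fastforce simp: comparable_def upper_right_def)
  qed auto
  moreover have "?N - {c} \<times> {b..j} = upper_right" by (auto simp: upper_right_def)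
  ultimately show ?thesis
    unfolding comparable_corner by (simp add: card_cartesian_product)
qed

lemma ferrers_upper_right: "ferrers \<kappa> j upper_right"
proof (rule ferrersI)
  show "inj_on \<kappa> (fst ` upper_right)"
    by (rule inj_on_subset[OF inj]) (auto simp: upper_right_def)
  fix i l assume il: "(i, l) \<in> upper_right"
  then have il': "(i, l) \<in> V" "i \<noteq> c" "j \<le> l" by (simp_all add: upper_right_def)
  show "j \<le> l" by (rule il')
  show "(i, l') \<in> upper_right" if "j \<le> l'" "l' \<le> l" for l'
    using down[OF il'(1), of l'] that base_le_corner il'(2) by (simp add: upper_right_def)
  show "(k, l) \<in> upper_right" if "(k, l') \<in> upper_right" "\<kappa> i < \<kappa> k" for k l'
    using nested[OF il'(1), of k] imageI[of "(k, l')" V fst] that il'(3)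
    by (simp add: upper_right_def)
qed (use fin in \<open>simp add: upper_right_def\<close>)

lemma ferrers_remove_corner: "ferrers \<kappa> b (V - {(c, j)})"
proof (rule ferrersI)
  show "inj_on \<kappa> (fst ` (V - {(c, j)}))"
    by (rule inj_on_subset[OF inj]) auto
  fix i l assume il: "(i, l) \<in> V - {(c, j)}"
  then have il': "(i, l) \<in> V" by simp
  show "b \<le> l" using base[OF il'] .
  show "(i, l') \<in> V - {(c, j)}" if "b \<le> l'" "l' \<le> l" for l'
    using down[OF il' that] il that corner_column[of l] by auto
  show "(k, l) \<in> V - {(c, j)}" if kl: "(k, l') \<in> V - {(c, j)}" and less: "\<kappa> i < \<kappa> k" for k l'
  proof -
    have "\<kappa> c \<le> \<kappa> i" using first[of i] imageI[OF il', of fst] by simp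
    moreover have "k \<in> fst ` V" using imageI[of "(k, l')" V fst] kl by simp
    ultimately show ?thesis using nested[OF il' _ less] less by auto
  qed
qed (use fin in simp)

lemma single_column:
  assumes "fst ` V = {c}"
  shows "has_mult \<kappa> V 1"
proof -
  have V: "V = {c} \<times> {b..j}"
  proof (rule Set.set_eqI)
    fix w :: vertex
    obtain k l where w: "w = (k, l)" by force
    show "w \<in> V \<longleftrightarrow> w \<in> {c} \<times> {b..j}"
      using assms corner_column[of l] by (force simp: w)
  qed
  show ?thesis
  proof (rule has_mult_remove_free_set[of _ _ V])
    have "snd ` V = {b..j}" unfolding V by force
    then show "shape_dim V = card V + shape_dim (V - V)"
      using assms base_le_corner by (simp add: shape_dim_def V card_cartesian_product)
  qed (use fin V in \<open>auto simp: has_mult_empty comparable_def\<close>)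
qed

text \<open>Passing to the upper right part loses the column \<open>c\<close> and the \<open>j - b\<close> rows below \<open>j\<close>: exactly as
many dimensions as there are vertices in column \<open>c\<close>.\<close>

lemma shape_dim_upper_right:
  assumes "fst ` V \<noteq> {c}"
  shows "shape_dim V = shape_dim upper_right + (Suc j - b)"
proof -
  obtain k where k: "k \<in> fst ` V" "k \<noteq> c" using assms corner(1) by force
  have kj: "(k, j) \<in> upper_right" using rectangle[OF k(1) base_le_corner] k(2) by (simp add: upper_right_def)
  have 1: "fst ` upper_right = fst ` V - {c}"
  proof
    show "fst ` V - {c} \<subseteq> fst ` upper_right"
    proof
      fix x assume x: "x \<in> fst ` V - {c}"
      then have "(x, j) \<in> upper_right" using rectangle[of x j] base_le_corner by (simp add: upper_right_def)
      then show "x \<in> fst ` upper_right" by force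
    qed
  qed (auto simp: upper_right_def)
  have 2: "snd ` V = {b..<j} \<union> snd ` upper_right"
  proof
    show "snd ` V \<subseteq> {b..<j} \<union> snd ` upper_right"
    proof
      fix l assume "l \<in> snd ` V"
      then obtain i where il: "(i, l) \<in> V" by force
      show "l \<in> {b..<j} \<union> snd ` upper_right"
      proof (cases "l < j")
        case True
        then show ?thesis using base[OF il] by simp
      next
        case False
        show ?thesis
        proof (cases "i = c")
          case True
          then have "l = j" using il corner_column False by simp
          then show ?thesis using kj by force
        next
          case ic: False
          then have "(i, l) \<in> upper_right" using il False by (simp add: upper_right_def)
          then show ?thesis by force
        qed
      qed
    qed
    have "{b..<j} \<subseteq> snd ` V"
    proof
      fix l assume "l \<in> {b..<j}"
      then have "(c, l) \<in> V" using corner_column by simp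
      then show "l \<in> snd ` V" by force
    qed
    then show "{b..<j} \<union> snd ` upper_right \<subseteq> snd ` V" by (auto simp: upper_right_def)
  qed
  have fU: "finite upper_right" using fin by (simp add: upper_right_def)
  have "card (snd ` V) = card {b..<j} + card (snd ` upper_right)"
    unfolding 2 by (rule card_Un_disjoint) (use fU in \<open>auto simp: upper_right_def\<close>)
  moreover have "card (fst ` V) = Suc (card (fst ` upper_right))"
    unfolding 1 using fin corner(1) by (metis card_Suc_Diff1 finite_imageI fst_conv imageI)
  moreover have "card (fst ` upper_right) > 0" "card (snd ` upper_right) > 0"
    using kj fU by (auto simp: card_gt_0_iff)
  ultimately show ?thesis
    using base_le_corner by (simp add: shape_dim_def)
qed

text \<open>Row \<open>j\<close> is also met by the other columns and column \<open>c\<close> also by row \<open>b\<close>, so the shape without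
its corner has the same rows and columns.\<close>

lemma shape_dim_remove_corner:
  assumes "fst ` V \<noteq> {c}" "b < j"
  shows "shape_dim (V - {(c, j)}) = shape_dim V"
proof -
  obtain k where k: "k \<in> fst ` V" "k \<noteq> c" using assms(1) corner(1) by force
  have "(k, j) \<in> V - {(c, j)}" "(c, b) \<in> V - {(c, j)}"
    using rectangle[OF k(1) base_le_corner] k(2) corner_column assms(2) by auto
  then have "j \<in> snd ` (V - {(c, j)})" "c \<in> fst ` (V - {(c, j)})" by (force, force)
  moreover have "f ` (V - {(c, j)}) = f ` V" if "f (c, j) \<in> f ` (V - {(c, j)})" for f :: "vertex \<Rightarrow> nat"
    using that by blast
  ultimately have "fst ` (V - {(c, j)}) = fst ` V" "snd ` (V - {(c, j)}) = snd ` V" by auto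
  then show ?thesis by (simp add: shape_dim_def)
qed

text \<open>All three terms of the recursion for the chain series acquire polynomial numerators over the same
power of \<open>1 - t\<close>. The factor \<open>t\<close> in front of the second summand disappears at \<open>t = 1\<close>.\<close>

lemma has_mult_corner:
  assumes "fst ` V \<noteq> {c}" "b < j"
    and e1: "has_mult \<kappa> (V - {(c, j)}) e\<^sub>1" and e2: "has_mult \<kappa> upper_right e\<^sub>2"
  shows "has_mult \<kappa> V (e\<^sub>1 + e\<^sub>2)"
proof -
  obtain Q\<^sub>1 where Q1: "chain_series \<kappa> (V - {(c, j)}) * (1 - fps_X) ^ shape_dim V = fps_of_poly Q\<^sub>1"
      "e\<^sub>1 = poly Q\<^sub>1 1"
    using e1 shape_dim_remove_corner[OF assms(1,2)] by (auto simp: has_mult_def)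
  obtain Q\<^sub>2 where Q2: "chain_series \<kappa> upper_right * (1 - fps_X) ^ shape_dim upper_right = fps_of_poly Q\<^sub>2"
      "e\<^sub>2 = poly Q\<^sub>2 1"
    using e2 by (auto simp: has_mult_def)
  let ?N = "{w \<in> V. comparable \<kappa> (c, j) w}"
  have "chain_series \<kappa> ?N * (1 - fps_X) ^ shape_dim V
      = chain_series \<kappa> ?N * (1 - fps_X) ^ (Suc j - b) * (1 - fps_X) ^ shape_dim upper_right"
    unfolding shape_dim_upper_right[OF assms(1)] power_add by (simp only: ac_simps)
  then have "chain_series \<kappa> ?N * (1 - fps_X) ^ shape_dim V = fps_of_poly Q\<^sub>2"
    by (simp only: chain_series_upper_right Q2(1))
  then have "chain_series \<kappa> V * (1 - fps_X) ^ shape_dim V = fps_of_poly (Q\<^sub>1 + pCons 0 Q\<^sub>2)"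
    using Q1(1) chain_series_remove[OF fin corner(1), of \<kappa>]
    by (simp add: fps_of_poly_add fps_of_poly_pCons distrib_right mult.assoc)
  then show ?thesis
    unfolding has_mult_def using Q1(2) Q2(2) by (intro exI[of _ "Q\<^sub>1 + pCons 0 Q\<^sub>2"]) simp
qed

end

text \<open>Cutting off the corner of the first column reduces every shape to shapes with a single column,
which are polynomial rings.\<close>

theorem ferrers_has_mult:
  assumes "ferrers \<kappa> b V"
  shows "\<exists>e. has_mult \<kappa> V e"
proof -
  have "finite V" using assms by (rule ferrersD)
  then show ?thesis
    using assms
  proof (induction V arbitrary: b rule: finite_psubset_induct)
    case (psubset V)
    note f = ferrersD[OF psubset.prems]
    show ?case
    proof (cases "V = {}")
      case False
      define c where "c = arg_min_on \<kappa> (fst ` V)"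
      have c: "c \<in> fst ` V" "\<And>k. k \<in> fst ` V \<Longrightarrow> \<kappa> c \<le> \<kappa> k"
        unfolding c_def using False psubset.hyps
        by (auto intro: arg_min_if_finite arg_min_least simp del: image_iff)
      define C where "C = {j. (c, j) \<in> V}"
      have C: "finite C" "C \<noteq> {}"
      proof -
        have "C \<subseteq> snd ` V" by (force simp: C_def)
        then show "finite C" using psubset.hyps finite_subset by blast
        show "C \<noteq> {}" using c(1) by (auto simp: C_def)
      qed
      define j where "j = Max C"
      interpret ferrers_corner \<kappa> b V c j
      proof
        show "(c, j) \<in> V" using Max_in[OF C] by (simp add: C_def j_def)
        show "(c, Suc j) \<notin> V" using Max_ge[OF C(1), of "Suc j"] by (auto simp: C_def j_def)
      qed (use psubset.prems c in auto)
      have sub: "upper_right \<subset> V" "V - {(c, j)} \<subset> V"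
        using corner(1) unfolding upper_right_def by force+
      obtain e1 where e1: "has_mult \<kappa> (V - {(c, j)}) e1"
        using psubset.IH[OF sub(2) ferrers_remove_corner] by blast
      obtain e2 where e2: "has_mult \<kappa> upper_right e2"
        using psubset.IH[OF sub(1) ferrers_upper_right] by blast
      \<comment> \<open>For \<open>j = b\<close> the column \<open>c\<close> consists of the corner only, which is then a free variable.\<close>
      consider "fst ` V = {c}" | "fst ` V \<noteq> {c}" "b < j" | "fst ` V \<noteq> {c}" "j = b"
        using base_le_corner by linarith
      then show ?thesis
      proof cases
        case 1
        then show ?thesis using single_column by blast
      next
        case 2
        then show ?thesis using has_mult_corner e1 e2 by blast
      next
        case 3
        have eq: "V - {(c, j)} = upper_right"
        proof (rule Set.set_eqI)
          fix v
          have "j \<le> snd v" if "v \<in> V" using base[of "fst v" "snd v"] that 3(2) by simp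
          moreover have "snd v = j" if "v \<in> V" "fst v = c"
            using corner_column[of "snd v"] that 3(2) by (metis le_antisym prod.collapse)
          ultimately show "v \<in> V - {(c, j)} \<longleftrightarrow> v \<in> upper_right"
            unfolding upper_right_def by auto
        qed
        have "comparable \<kappa> (c, j) w" if "w \<in> V" for w
        proof -
          have "w = (c, j) \<or> w \<in> upper_right" unfolding eq [symmetric] using that by simp
          then show ?thesis
          proof
            assume "w \<in> upper_right"
            then have "w \<in> {w \<in> V. comparable \<kappa> (c, j) w}" unfolding comparable_corner by simp
            then show ?thesis by simp
          qed simp
        qed
        then have "has_mult \<kappa> V e1"
          using has_mult_remove_free[OF e1 fin corner(1)] shape_dim_upper_right[OF 3(1)] 3(2)
          unfolding eq by simp
        then show ?thesis by blast
      qed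
    qed (use has_mult_empty in blast)
  qed
qed

section \<open>The polynomial ring\<close>

text \<open>The polynomial ring, the target of the toric map and the ground field are all of this form, so one
proof of the ring axioms serves the three.\<close>

definition type_ring :: "'a::comm_ring_1 set \<Rightarrow> 'a ring" where
  "type_ring C = \<lparr>carrier = C, monoid.mult = (*), one = 1, zero = 0, add = (+)\<rparr>"

lemma type_ring_simps [simp]:
  "carrier (type_ring C) = C" "monoid.mult (type_ring C) = (*)" "one (type_ring C) = 1"
  "zero (type_ring C) = 0" "add (type_ring C) = (+)"
  by (simp_all add: type_ring_def)

lemma cring_type_ring:
  assumes "0 \<in> C" "1 \<in> C" "\<And>x y. x \<in> C \<Longrightarrow> y \<in> C \<Longrightarrow> x + y \<in> C"
    "\<And>x y. x \<in> C \<Longrightarrow> y \<in> C \<Longrightarrow> x * y \<in> C" "\<And>x. x \<in> C \<Longrightarrow> - x \<in> C"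
  shows "cring (type_ring C)"
proof (rule cringI)
  show "abelian_group (type_ring C)"
  proof (rule abelian_groupI)
    fix x assume "x \<in> carrier (type_ring C)"
    then show "\<exists>y\<in>carrier (type_ring C). y \<oplus>\<^bsub>type_ring C\<^esub> x = \<zero>\<^bsub>type_ring C\<^esub>"
      using assms(5) by (intro bexI[of _ "- x"]) auto
  qed (use assms in \<open>simp_all add: add_ac\<close>)
  show "comm_monoid (type_ring C)"
    by (rule comm_monoidI) (use assms in \<open>simp_all add: mult_ac\<close>)
qed (simp add: distrib_right)

lemma type_ring_minus:
  assumes "cring (type_ring C)" "x \<in> C" "y \<in> C" "- y \<in> C"
  shows "x \<ominus>\<^bsub>type_ring C\<^esub> y = x - y"
proof -
  interpret cring "type_ring C" by fact
  have "\<ominus>\<^bsub>type_ring C\<^esub> y = - y"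
    by (rule minus_equality) (use assms in auto)
  then show ?thesis by (simp add: a_minus_def)
qed

lemma domain_type_ring_UNIV: "domain (type_ring (UNIV :: 'a::idom set))"
  by (intro domain.intro domain_axioms.intro cring_type_ring) auto

definition polys_in :: "vertex set \<Rightarrow> 'k::field mpoly set" where
  "polys_in V = {p. \<forall>t\<in>Poly_Mapping.keys p. Poly_Mapping.keys t \<subseteq> V}"

lemma poly_ring_eq: "poly_ring V = type_ring (polys_in V)"
  by (simp add: poly_ring_def type_ring_def polys_in_def)

lemma carrier_poly_ring [simp]: "carrier (poly_ring V) = polys_in V"
  by (simp add: poly_ring_eq)

lemma polys_in_add: "p \<in> polys_in V \<Longrightarrow> q \<in> polys_in V \<Longrightarrow> p + q \<in> polys_in V"
  using keys_add[of p q] unfolding polys_in_def by blast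

lemma keys_uminus [simp]: "Poly_Mapping.keys (- p) = Poly_Mapping.keys p"
  for p :: "'a \<Rightarrow>\<^sub>0 'b::ab_group_add"
  by (auto simp: in_keys_iff)

lemma polys_in_uminus: "p \<in> polys_in V \<Longrightarrow> - p \<in> polys_in V"
  by (simp add: polys_in_def)

lemma polys_in_diff: "p \<in> polys_in V \<Longrightarrow> q \<in> polys_in V \<Longrightarrow> p - q \<in> polys_in V"
  using polys_in_add[of p V "- q"] polys_in_uminus[of q V] by simp

lemma polys_in_mult: "p \<in> polys_in V \<Longrightarrow> q \<in> polys_in V \<Longrightarrow> p * q \<in> polys_in V"
  using keys_mult[of p q] unfolding polys_in_def by (fastforce simp: keys_add_nat)

lemma polys_in_single: "Poly_Mapping.keys t \<subseteq> V \<Longrightarrow> Poly_Mapping.single t c \<in> polys_in V"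
  by (simp add: polys_in_def)

lemma polys_in_const [simp]: "const c \<in> polys_in V"
  by (simp add: const_def polys_in_single)

lemma polys_in_0 [simp]: "0 \<in> polys_in V"
  by (simp add: polys_in_def)

lemma polys_in_1 [simp]: "1 \<in> polys_in V"
  by (simp add: polys_in_def)

lemma cring_poly_ring: "cring (poly_ring V :: 'k::field mpoly ring)"
  unfolding poly_ring_eq
  by (rule cring_type_ring) (auto intro: polys_in_add polys_in_mult polys_in_uminus)

lemma poly_ring_minus:
  assumes "p \<in> polys_in V" "q \<in> polys_in V"
  shows "p \<ominus>\<^bsub>poly_ring V\<^esub> q = p - q"
  unfolding poly_ring_eq
  by (rule type_ring_minus[OF cring_poly_ring[unfolded poly_ring_eq] assms polys_in_uminus[OF assms(2)]])

lemma subfield_const: "subfield (range const) (poly_ring V :: 'k::field mpoly ring)"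
proof -
  interpret S: cring "poly_ring V :: 'k mpoly ring" by (rule cring_poly_ring)
  have eq: "(poly_ring V) \<lparr>carrier := range const\<rparr> = type_ring (range (const :: 'k \<Rightarrow> _))"
    by (simp add: poly_ring_def type_ring_def)
  have c: "cring (type_ring (range (const :: 'k \<Rightarrow> _)))"
  proof (rule cring_type_ring)
    show "0 \<in> range (const :: 'k \<Rightarrow> _)" by (rule range_eqI[of _ _ 0]) (simp add: const_def)
    show "1 \<in> range (const :: 'k \<Rightarrow> _)" by (rule range_eqI[of _ _ 1]) (simp add: const_def)
    fix p q :: "'k mpoly" assume "p \<in> range const" "q \<in> range const"
    then obtain a b where ab: "p = const a" "q = const b" by blast
    show "p + q \<in> range const" unfolding ab
      by (rule range_eqI[of _ _ "a + b"]) (simp add: const_def single_add)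
    show "p * q \<in> range const" unfolding ab
      by (rule range_eqI[of _ _ "a * b"]) (simp add: const_def mult_single)
    show "- p \<in> range const" unfolding ab
      by (rule range_eqI[of _ _ "- a"]) (simp add: const_def single_uminus)
  qed
  have "field (type_ring (range (const :: 'k \<Rightarrow> _)))"
  proof (rule cring.cring_fieldI2[OF c])
    fix p :: "'k mpoly"
    assume p: "p \<in> carrier (type_ring (range const))" "p \<noteq> \<zero>\<^bsub>type_ring (range const)\<^esub>"
    then obtain a where a: "p = const a" by auto
    moreover have "a \<noteq> 0" using p(2) unfolding a by (auto simp: const_def)
    ultimately
    show "\<exists>b\<in>carrier (type_ring (range const)). p \<otimes>\<^bsub>type_ring (range const)\<^esub> b = \<one>\<^bsub>type_ring (range const)\<^esub>"
      by (intro bexI[of _ "const (inverse a)"]) (auto simp: const_def mult_single)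
  qed simp
  then show ?thesis
    using S.subfield_iff(1)[of "range const"] unfolding eq by (simp add: image_subset_iff)
qed

section \<open>The toric map\<close>

lemma poly_mapping_update_eq:
  assumes "a \<notin> Poly_Mapping.keys f"
  shows "Poly_Mapping.update a b f = f + Poly_Mapping.single a b"
  using assms
  by (intro poly_mapping_eqI) (auto simp: lookup_update lookup_add lookup_single when_def in_keys_iff)

lemma poly_mapping_add_induct [case_names zero add]:
  assumes "P 0"
    and "\<And>p t c. t \<notin> Poly_Mapping.keys p \<Longrightarrow> c \<noteq> 0 \<Longrightarrow>
           Poly_Mapping.keys (p + Poly_Mapping.single t c) = insert t (Poly_Mapping.keys p) \<Longrightarrow>
           P p \<Longrightarrow> P (p + Poly_Mapping.single t c)"
  shows "P p"
proof (induction p rule: update_induct)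
  case (update p t c)
  have "Poly_Mapping.keys (p + Poly_Mapping.single t c) = insert t (Poly_Mapping.keys p)"
    using update(1,2) poly_mapping_update_eq[OF update(1), of c] by (metis keys_update)
  then show ?case
    using assms(2)[OF update(1,2) _ update(3)] poly_mapping_update_eq[OF update(1), of c] by simp
qed (rule assms(1))

text \<open>Polynomials in the variables \<open>s(i)\<close> and \<open>t(j)\<close> of the toric map. They are numbered by \<open>2 i\<close> and
\<open>2 j + 1\<close>: a linearly ordered index type makes the monomials linearly ordered and thus the
polynomials an integral domain.\<close>

type_synonym 'k torus = "(nat \<Rightarrow>\<^sub>0 nat) \<Rightarrow>\<^sub>0 'k"

definition linear_ext :: "(monomial \<Rightarrow> 'k::field torus) \<Rightarrow> 'k mpoly \<Rightarrow> 'k torus" where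
  "linear_ext w p =
     (\<Sum>t\<in>Poly_Mapping.keys p. Poly_Mapping.single 0 (Poly_Mapping.lookup p t) * w t)"

lemma linear_ext_0 [simp]: "linear_ext w 0 = 0"
  by (simp add: linear_ext_def)

lemma linear_ext_single [simp]:
  "linear_ext w (Poly_Mapping.single t c) = Poly_Mapping.single 0 c * w t"
  by (simp add: linear_ext_def)

lemma linear_ext_add: "linear_ext w (p + q) = linear_ext w p + linear_ext w q"
  unfolding linear_ext_def
  by (rule setsum_keys_plus_distrib) (simp_all add: single_add distrib_right)

lemma linear_ext_mult:
  assumes w: "\<And>s t. w (s + t) = w s * w t"
  shows "linear_ext w (p * q) = linear_ext w p * linear_ext w q"
proof (induction p rule: poly_mapping_add_induct)
  case (add p s c)
  have "linear_ext w (Poly_Mapping.single s c * q) = Poly_Mapping.single 0 c * w s * linear_ext w q"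
  proof (induction q rule: poly_mapping_add_induct)
    case (add q t d)
    have "Poly_Mapping.single 0 (c * d) = Poly_Mapping.single 0 c * Poly_Mapping.single (0 :: nat \<Rightarrow>\<^sub>0 nat) d"
      by (simp add: mult_single)
    then show ?case
      using add by (simp add: linear_ext_add distrib_left mult_single w mult_ac)
  qed simp
  then show ?case using add by (simp add: linear_ext_add distrib_right)
qed simp

text \<open>The two variables whose product is the image of the vertex.\<close>

definition nodes :: "vertex \<Rightarrow> nat set" where
  "nodes v = {2 * fst v, 2 * snd v + 1}"

text \<open>The exponent of the image of a monomial: its column sums and its row sums.\<close>

definition marginal :: "monomial \<Rightarrow> nat \<Rightarrow>\<^sub>0 nat" where
  "marginal t = (\<Sum>v\<in>Poly_Mapping.keys t.
     Poly_Mapping.single (2 * fst v) (Poly_Mapping.lookup t v) +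
     Poly_Mapping.single (2 * snd v + 1) (Poly_Mapping.lookup t v))"

text \<open>The image of a monomial under the toric map followed by setting the variables in \<open>A\<close> to zero. The
kernels for growing \<open>A\<close> yield the chains of prime ideals.\<close>

definition toric_weight :: "nat set \<Rightarrow> monomial \<Rightarrow> 'k::field torus" where
  "toric_weight A t = (if \<forall>v\<in>Poly_Mapping.keys t. nodes v \<inter> A = {}
     then Poly_Mapping.single (marginal t) 1 else 0)"

definition toric :: "nat set \<Rightarrow> 'k::field mpoly \<Rightarrow> 'k torus" where
  "toric A = linear_ext (toric_weight A)"

lemma marginal_0 [simp]: "marginal 0 = 0"
  by (simp add: marginal_def)

lemma marginal_add: "marginal (s + t) = marginal s + marginal t"
  unfolding marginal_def by (rule setsum_keys_plus_distrib) (simp_all add: single_add add_ac)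

lemma marginal_single [simp]:
  "marginal (Poly_Mapping.single v c) =
     Poly_Mapping.single (2 * fst v) c + Poly_Mapping.single (2 * snd v + 1) c"
  by (simp add: marginal_def)

lemma keys_marginal: "Poly_Mapping.keys (marginal t) = (\<Union>v\<in>Poly_Mapping.keys t. nodes v)"
proof (induction t rule: poly_mapping_add_induct)
  case (add t v c)
  then show ?case
    by (simp add: marginal_add keys_add_nat nodes_def Un_commute insert_commute)
qed simp

lemma toric_weight_add: "toric_weight A (s + t) = toric_weight A s * toric_weight A t"
  by (auto simp: toric_weight_def keys_add_nat mult_single marginal_add)

lemma toric_add: "toric A (p + q) = toric A p + toric A q"
  by (simp add: toric_def linear_ext_add)

lemma toric_mult: "toric A (p * q) = toric A p * toric A q"
  unfolding toric_def by (rule linear_ext_mult) (rule toric_weight_add)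

lemma toric_0 [simp]: "toric A 0 = 0"
  by (simp add: toric_def)

lemma toric_const: "toric A (const c) = Poly_Mapping.single 0 c"
  by (simp add: toric_def const_def toric_weight_def mult_single)

lemma toric_1 [simp]: "toric A 1 = 1"
  using toric_const[of A 1] by (simp add: const_def)

lemma toric_uminus: "toric A (- p) = - toric A p"
  using toric_add[of A p "- p"] by (simp add: eq_neg_iff_add_eq_0 add.commute)

lemma toric_diff: "toric A (p - q) = toric A p - toric A q"
  using toric_add[of A p "- q"] by (simp add: toric_uminus)

lemma toric_var: "toric A (var v) = (if nodes v \<inter> A = {} then Poly_Mapping.single (marginal (Poly_Mapping.single v 1)) 1 else 0)"
  by (simp add: toric_def var_def toric_weight_def)

text \<open>Both products involve the columns \<open>i\<close>, \<open>k\<close> and the rows \<open>j\<close>, \<open>l\<close> once each.\<close>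

lemma toric_var_swap: "toric A (var (i, l) * var (k, j)) = toric A (var (i, j) * var (k, l))"
  unfolding toric_mult toric_var
  by (auto simp: nodes_def mult_single add_ac)

lemma toric_inner_binomial: "p \<in> inner_binomials P \<Longrightarrow> toric A p = 0"
  by (auto simp: inner_binomials_def toric_diff toric_var_swap)

lemma toric_hom: "ring_hom_ring (poly_ring V) (type_ring UNIV) (toric A :: 'k::field mpoly \<Rightarrow> _)"
proof (rule ring_hom_ringI)
  show "ring (poly_ring V :: 'k mpoly ring)" using cring_poly_ring by (rule cring.axioms)
  show "ring (type_ring (UNIV :: 'k torus set))"
    using domain_type_ring_UNIV[where 'a="'k torus"] by (simp add: domain_def cring_def)
qed (simp_all add: toric_mult toric_add poly_ring_eq)

lemma inner_binomials_polys_in: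
  "inner_binomials P \<subseteq> (polys_in (vertices P) :: 'k::field mpoly set)"
proof
  fix p :: "'k mpoly" assume "p \<in> inner_binomials P"
  then obtain i j k l where p: "p = var (i, l) * var (k, j) - var (i, j) * var (k, l)"
    and less: "i < k" "j < l"
    and cells: "\<And>r s. i \<le> r \<Longrightarrow> r < k \<Longrightarrow> j \<le> s \<Longrightarrow> s < l \<Longrightarrow> (r, s) \<in> P"
    unfolding inner_binomials_def by blast
  have "(i, j) \<in> P" "(i, l - 1) \<in> P" "(k - 1, j) \<in> P" "(k - 1, l - 1) \<in> P"
    using less by (auto intro!: cells)
  moreover have "(i, j) \<in> cell_vertices (i, j)" "(i, l) \<in> cell_vertices (i, l - 1)"
    "(k, j) \<in> cell_vertices (k - 1, j)" "(k, l) \<in> cell_vertices (k - 1, l - 1)"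
    using less by (auto simp: cell_vertices_def)
  ultimately have "(i, j) \<in> vertices P" "(i, l) \<in> vertices P" "(k, j) \<in> vertices P" "(k, l) \<in> vertices P"
    unfolding vertices_def by blast+
  then show "p \<in> polys_in (vertices P)"
    unfolding p by (intro polys_in_diff polys_in_mult) (simp_all add: var_def polys_in_single)
qed

lemma polyomino_ideal_ideal: "ideal (polyomino_ideal P) (poly_ring (vertices P) :: 'k::field mpoly ring)"
proof -
  interpret S: cring "poly_ring (vertices P) :: 'k mpoly ring" by (rule cring_poly_ring)
  show ?thesis
    unfolding polyomino_ideal_def by (rule S.genideal_ideal) (simp add: inner_binomials_polys_in)
qed

lemma inner_binomials_in_ideal: "inner_binomials P \<subseteq> (polyomino_ideal P :: 'k::field mpoly set)"
proof -
  interpret S: cring "poly_ring (vertices P) :: 'k mpoly ring" by (rule cring_poly_ring)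
  show ?thesis
    unfolding polyomino_ideal_def by (rule S.genideal_self) (simp add: inner_binomials_polys_in)
qed

lemma polyomino_ideal_toric:
  assumes "p \<in> polyomino_ideal P"
  shows "toric A (p :: 'k::field mpoly) = 0"
proof -
  interpret H: ring_hom_ring "poly_ring (vertices P)" "type_ring UNIV" "toric A :: 'k mpoly \<Rightarrow> _"
    by (rule toric_hom)
  have "polyomino_ideal P \<subseteq> a_kernel (poly_ring (vertices P)) (type_ring UNIV) (toric A :: 'k mpoly \<Rightarrow> _)"
    unfolding polyomino_ideal_def
  proof (rule H.R.genideal_minimal)
    show "ideal (a_kernel (poly_ring (vertices P)) (type_ring UNIV) (toric A :: 'k mpoly \<Rightarrow> _)) (poly_ring (vertices P))"
      by (rule H.kernel_is_ideal)
    show "inner_binomials P \<subseteq> a_kernel (poly_ring (vertices P)) (type_ring UNIV) (toric A :: 'k mpoly \<Rightarrow> _)"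
      using inner_binomials_polys_in[where 'k='k] toric_inner_binomial unfolding a_kernel_def' by fastforce
  qed
  then show ?thesis using assms unfolding a_kernel_def' by auto
qed

lemma polyomino_ideal_closed:
  fixes p q r :: "'k::field mpoly"
  shows "p \<in> polyomino_ideal P \<Longrightarrow> q \<in> polyomino_ideal P \<Longrightarrow> p + q \<in> polyomino_ideal P"
    and "r \<in> polys_in (vertices P) \<Longrightarrow> p \<in> polyomino_ideal P \<Longrightarrow> r * p \<in> polyomino_ideal P"
    and "p \<in> polyomino_ideal P \<Longrightarrow> - p \<in> polyomino_ideal P"
    and "(0 :: 'k mpoly) \<in> polyomino_ideal P"
proof -
  interpret I: ideal "polyomino_ideal P" "poly_ring (vertices P) :: 'k mpoly ring"
    by (rule polyomino_ideal_ideal)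
  show "p + q \<in> polyomino_ideal P" if "p \<in> polyomino_ideal P" "q \<in> polyomino_ideal P"
    using additive_subgroup.a_closed[OF I.additive_subgroup_axioms that] by (simp add: poly_ring_eq)
  have mult: "r * p \<in> polyomino_ideal P" if "r \<in> polys_in (vertices P)" "p \<in> polyomino_ideal P" for r p :: "'k mpoly"
    using I.I_l_closed[OF that(2)] that(1) by (simp add: poly_ring_eq)
  then show "r * p \<in> polyomino_ideal P" if "r \<in> polys_in (vertices P)" "p \<in> polyomino_ideal P"
    using that .
  have "- 1 \<in> (polys_in (vertices P) :: 'k mpoly set)" by (rule polys_in_uminus) simp
  then show "- p \<in> polyomino_ideal P" if "p \<in> polyomino_ideal P"
    using mult[OF _ that, of "- 1"] by simp
  show "(0 :: 'k mpoly) \<in> polyomino_ideal P"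
    using additive_subgroup.zero_closed[OF I.additive_subgroup_axioms] by (simp add: poly_ring_eq)
qed

section \<open>Chain monomials form a basis of the coordinate ring\<close>

text \<open>The last column of a chain meets its highest row: a vertex of that row in an earlier column forces
every vertex of the last column to be at least as high.\<close>

lemma chain_top_vertex:
  assumes chain: "is_chain \<kappa> S" and inj: "inj_on \<kappa> (fst ` S)"
    and k: "k \<in> fst ` S" "\<And>i. i \<in> fst ` S \<Longrightarrow> \<kappa> i \<le> \<kappa> k"
    and l: "l \<in> snd ` S" "\<And>j. j \<in> snd ` S \<Longrightarrow> j \<le> l"
  shows "(k, l) \<in> S"
proof -
  obtain i where il: "(i, l) \<in> S" using l(1) by force
  obtain j where kj: "(k, j) \<in> S" using k(1) by force
  show ?thesis
  proof (cases "i = k")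
    case False
    have i: "i \<in> fst ` S" using il by force
    then have "\<kappa> i < \<kappa> k"
      using inj k False by (metis inj_on_def le_neq_implies_less)
    then have "l \<le> j"
      using chain il kj by (fastforce simp: is_chain_def comparable_def)
    moreover have "j \<le> l" using l(2) kj by force
    ultimately show ?thesis using kj by simp
  qed (use il in simp)
qed

text \<open>The marginals determine the last column and the highest row that occur, hence a vertex at which
both monomials can be divided.\<close>

lemma chain_monomial_determined_by_marginal:
  assumes "is_chain \<kappa> (Poly_Mapping.keys s)" "is_chain \<kappa> (Poly_Mapping.keys t)"
    and "inj_on \<kappa> (fst ` (Poly_Mapping.keys s \<union> Poly_Mapping.keys t))"
    and "marginal s = marginal t"
  shows "s = t"
  using assms
proof (induction "mon_degree s" arbitrary: s t)
  case 0
  then have "s = 0" by (simp add: mon_degree_eq_0_iff)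
  then have "(\<Union>v\<in>Poly_Mapping.keys t. nodes v) = {}"
    using 0(5) by (simp flip: keys_marginal)
  then have "Poly_Mapping.keys t = {}" by (auto simp: nodes_def simp del: keys_eq_empty)
  then show ?case using \<open>s = 0\<close> by simp
next
  case (Suc d)
  have nodes: "fst ` Poly_Mapping.keys u = {i. 2 * i \<in> Poly_Mapping.keys (marginal u)}"
    "snd ` Poly_Mapping.keys u = {j. 2 * j + 1 \<in> Poly_Mapping.keys (marginal u)}" for u
    unfolding keys_marginal nodes_def by (auto simp: image_iff; presburger)+
  have fst_eq: "fst ` Poly_Mapping.keys s = fst ` Poly_Mapping.keys t"
    and snd_eq: "snd ` Poly_Mapping.keys s = snd ` Poly_Mapping.keys t"
    unfolding nodes Suc.prems(4) by simp_all
  have inj: "inj_on \<kappa> (fst ` Poly_Mapping.keys s)" "inj_on \<kappa> (fst ` Poly_Mapping.keys t)"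
    by (rule inj_on_subset[OF Suc.prems(3)]; auto)+
  have "s \<noteq> 0" using Suc(2) by auto
  then have ne: "Poly_Mapping.keys s \<noteq> {}" by simp
  have "Max (\<kappa> ` fst ` Poly_Mapping.keys s) \<in> \<kappa> ` fst ` Poly_Mapping.keys s"
    by (rule Max_in) (use ne in auto)
  then obtain k where k': "k \<in> fst ` Poly_Mapping.keys s" "\<kappa> k = Max (\<kappa> ` fst ` Poly_Mapping.keys s)"
    by (metis imageE)
  then have k: "k \<in> fst ` Poly_Mapping.keys s" "\<And>i. i \<in> fst ` Poly_Mapping.keys s \<Longrightarrow> \<kappa> i \<le> \<kappa> k"
    by simp_all
  define l where "l = Max (snd ` Poly_Mapping.keys s)"
  have l: "l \<in> snd ` Poly_Mapping.keys s" "\<And>j. j \<in> snd ` Poly_Mapping.keys s \<Longrightarrow> j \<le> l"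
    unfolding l_def using ne by auto
  have "(k, l) \<in> Poly_Mapping.keys s"
    using chain_top_vertex[OF Suc.prems(1) inj(1) k l] .
  moreover have "(k, l) \<in> Poly_Mapping.keys t"
    using chain_top_vertex[OF Suc.prems(2) inj(2)] k l unfolding fst_eq snd_eq by blast
  ultimately obtain s' t' where s': "s = s' + Poly_Mapping.single (k, l) 1"
    and t': "t = t' + Poly_Mapping.single (k, l) 1"
    by (metis monomial_split_var)
  have "s' = t'"
  proof (rule Suc.hyps(1))
    show "d = mon_degree s'" using Suc.hyps(2) by (simp add: s' mon_degree_add)
    show "is_chain \<kappa> (Poly_Mapping.keys s')" "is_chain \<kappa> (Poly_Mapping.keys t')"
      using Suc.prems(1,2) unfolding s' t' keys_add_nat is_chain_def by blast+
    show "inj_on \<kappa> (fst ` (Poly_Mapping.keys s' \<union> Poly_Mapping.keys t'))"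
      by (rule inj_on_subset[OF Suc.prems(3)]) (auto simp: s' t' keys_add_nat)
    show "marginal s' = marginal t'"
      using Suc.prems(4) unfolding s' t' marginal_add by simp
  qed
  then show ?case by (simp add: s' t')
qed

text \<open>The exchange step lowers the measure used for straightening: it pairs the larger column weight
with the lower row.\<close>

lemma crossing_decreases:
  fixes x y j l :: nat
  assumes "y < x" "j < l"
  shows "x * j + y * l < x * l + y * j"
proof -
  obtain d e where d: "x = y + d" "d > 0" and e: "l = j + e" "e > 0"
    using assms by (metis less_imp_add_positive)
  then show ?thesis by (simp add: algebra_simps)
qed

text \<open>Below a row at which two columns both have a vertex, the cells between these columns belong to
\<open>P\<close>. This turns every minor with its four corners in the shape into an inner binomial.\<close>

locale ferrers_polyomino =
  fixes \<kappa> :: "nat \<Rightarrow> nat" and b :: nat and P :: "cell set" and field_type :: "'k::field itself"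
  assumes ferrers: "ferrers \<kappa> b (vertices P)"
    and inner: "\<And>i k l j r s. (i, l) \<in> vertices P \<Longrightarrow> (k, l) \<in> vertices P \<Longrightarrow> i < k \<Longrightarrow> b \<le> j \<Longrightarrow>
      j < l \<Longrightarrow> i \<le> r \<Longrightarrow> r < k \<Longrightarrow> j \<le> s \<Longrightarrow> s < l \<Longrightarrow> (r, s) \<in> P"
begin

abbreviation "V \<equiv> vertices P"
abbreviation "I \<equiv> polyomino_ideal P :: 'k mpoly set"

lemmas fin = ferrersD(1)[OF ferrers]
  and inj = ferrersD(2)[OF ferrers]
  and base = ferrersD(3)[OF ferrers]
  and down = ferrersD(4)[OF ferrers]
  and nested = ferrersD(5)[OF ferrers]

text \<open>The numerical order of the columns \<open>i\<close> and \<open>k\<close> may differ from their order under \<open>\<kappa>\<close>; reversing it only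
changes the sign of the binomial.\<close>

lemma exchange:
  assumes "(i, l) \<in> V" "(k, j) \<in> V" "\<kappa> i < \<kappa> k" "j < l"
  shows "(i, j) \<in> V" "(k, l) \<in> V"
    "var (i, l) * var (k, j) - var (i, j) * var (k, l) \<in> I"
proof -
  have bj: "b \<le> j" by (rule base[OF assms(2)])
  show "(i, j) \<in> V" using down[OF assms(1) bj] assms(4) by simp
  have "k \<in> fst ` V" using assms(2) by force
  then show kl: "(k, l) \<in> V" using nested[OF assms(1) _ assms(3)] by blast
  consider "i < k" | "k < i" using assms(3) by (metis less_irrefl linorder_neqE_nat)
  then show "var (i, l) * var (k, j) - var (i, j) * var (k, l) \<in> I"
  proof cases
    case 1
    then have "var (i, l) * var (k, j) - var (i, j) * var (k, l) \<in> (inner_binomials P :: 'k mpoly set)"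
      unfolding inner_binomials_def using inner[OF assms(1) kl 1 bj assms(4)] assms(4) by blast
    then show ?thesis using inner_binomials_in_ideal by blast
  next
    case 2
    then have "var (k, l) * var (i, j) - var (k, j) * var (i, l) \<in> (inner_binomials P :: 'k mpoly set)"
      unfolding inner_binomials_def using inner[OF kl assms(1) 2 bj assms(4)] assms(4) by blast
    then have "- (var (k, l) * var (i, j) - var (k, j) * var (i, l)) \<in> I"
      by (intro polyomino_ideal_closed(3) subsetD[OF inner_binomials_in_ideal])
    then show ?thesis by (simp add: mult.commute)
  qed
qed

text \<open>An incomparable pair of vertices in the support is exchanged for a comparable one. This terminates
because the sum of \<open>(M - \<kappa> i) j\<close> over the vertices \<open>(i, j)\<close> of the monomial decreases.\<close>

lemma straighten:
  assumes "Poly_Mapping.keys t \<subseteq> V"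
  shows "\<exists>t'\<in>chain_monomials \<kappa> V (mon_degree t). Poly_Mapping.single t 1 - Poly_Mapping.single t' 1 \<in> I"
proof -
  obtain M where M: "\<And>v. v \<in> V \<Longrightarrow> \<kappa> (fst v) \<le> M"
    using finite_imageI[OF fin, of "\<lambda>v. \<kappa> (fst v)"] by (metis finite_nat_set_iff_bounded_le imageI)
  define wt where "wt t = (\<Sum>v\<in>Poly_Mapping.keys t. Poly_Mapping.lookup t v * ((M - \<kappa> (fst v)) * snd v))"
    for t :: monomial
  have wt_add: "wt (s + t) = wt s + wt t" for s t
    unfolding wt_def by (rule setsum_keys_plus_distrib) (simp_all add: distrib_right)
  have wt_single: "wt (Poly_Mapping.single v 1) = (M - \<kappa> (fst v)) * snd v" for v
    by (simp add: wt_def)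
  show ?thesis
    using assms
  proof (induction "wt t" arbitrary: t rule: less_induct)
    case less
    show ?case
    proof (cases "is_chain \<kappa> (Poly_Mapping.keys t)")
      case True
      then show ?thesis
        using less.prems by (intro bexI[of _ t]) (simp_all add: chain_monomials_def polyomino_ideal_closed(4))
    next
      case False
      then obtain v w where "v \<in> Poly_Mapping.keys t" "w \<in> Poly_Mapping.keys t" "\<not> comparable \<kappa> v w"
        unfolding is_chain_def by blast
      then obtain v w where vw: "v \<in> Poly_Mapping.keys t" "w \<in> Poly_Mapping.keys t"
        "\<kappa> (fst v) < \<kappa> (fst w)" "snd w < snd v"
        unfolding comparable_def by (metis not_le)
      obtain i l where v: "v = (i, l)" by force
      obtain k j where w: "w = (k, j)" by force
      have less': "\<kappa> i < \<kappa> k" "j < l" using vw(3,4) by (simp_all add: v w)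
      have "v \<noteq> w" using vw(3) by auto
      then obtain u where u: "t = u + Poly_Mapping.single v 1 + Poly_Mapping.single w 1"
        using monomial_split_two_vars[OF vw(1,2)] by blast
      have V: "(i, l) \<in> V" "(k, j) \<in> V" using vw(1,2) less.prems by (auto simp: v w)
      note ex = exchange[OF V less']
      define t1 where "t1 = u + Poly_Mapping.single (i, j) 1 + Poly_Mapping.single (k, l) (1::nat)"
      have keys_u: "Poly_Mapping.keys u \<subseteq> V" using less.prems by (simp add: u keys_add_nat)
      have keys_t1: "Poly_Mapping.keys t1 \<subseteq> V" using keys_u ex(1,2) by (simp add: t1_def keys_add_nat)
      have "M - \<kappa> k < M - \<kappa> i" using less'(1) M[OF V(2)] by simp
      from crossing_decreases[OF this less'(2)] have "wt t1 < wt t"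
        by (simp add: t1_def u v w wt_add wt_single del: One_nat_def)
      from less.hyps[OF this keys_t1] obtain t' where t': "t' \<in> chain_monomials \<kappa> V (mon_degree t1)"
        "Poly_Mapping.single t1 1 - Poly_Mapping.single t' 1 \<in> I" by blast
      have "Poly_Mapping.single u 1 * (var (i, l) * var (k, j) - var (i, j) * var (k, l)) \<in> I"
        by (rule polyomino_ideal_closed(2)[OF polys_in_single[OF keys_u] ex(3)])
      also have "Poly_Mapping.single u 1 * (var (i, l) * var (k, j) - var (i, j) * var (k, l))
          = Poly_Mapping.single t 1 - (Poly_Mapping.single t1 1 :: 'k mpoly)"
        by (simp add: u v w t1_def var_def right_diff_distrib mult_single add.assoc)
      finally have "Poly_Mapping.single t 1 - Poly_Mapping.single t1 1 +
          (Poly_Mapping.single t1 1 - Poly_Mapping.single t' 1) \<in> I"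
        using polyomino_ideal_closed(1)[OF _ t'(2)] by blast
      moreover have "mon_degree t1 = mon_degree t"
        by (simp add: t1_def u mon_degree_add)
      ultimately show ?thesis using t'(1) by (intro bexI[of _ t']) simp_all
    qed
  qed
qed

lemma normal_form:
  assumes "p \<in> polys_in V"
  shows "\<exists>q. Poly_Mapping.keys q \<subseteq> (\<Union>d\<in>mon_degree ` Poly_Mapping.keys p. chain_monomials \<kappa> V d) \<and> p - q \<in> I"
  using assms
proof (induction p rule: poly_mapping_add_induct)
  case zero
  then show ?case using polyomino_ideal_closed(4) by (intro exI[of _ 0]) simp
next
  case (add p t c)
  have p: "p \<in> polys_in V" and t: "Poly_Mapping.keys t \<subseteq> V"
    using add.prems add.hyps(3) by (auto simp: polys_in_def)
  obtain q where q: "Poly_Mapping.keys q \<subseteq> (\<Union>d\<in>mon_degree ` Poly_Mapping.keys p. chain_monomials \<kappa> V d)"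
    "p - q \<in> I" using add.IH[OF p] by blast
  obtain t' where t': "t' \<in> chain_monomials \<kappa> V (mon_degree t)"
    "Poly_Mapping.single t 1 - Poly_Mapping.single t' 1 \<in> I" using straighten[OF t] by blast
  have "const c * (Poly_Mapping.single t 1 - Poly_Mapping.single t' 1) \<in> I"
    by (rule polyomino_ideal_closed(2)[OF _ t'(2)]) simp
  then have "p - q + const c * (Poly_Mapping.single t 1 - Poly_Mapping.single t' 1) \<in> I"
    by (rule polyomino_ideal_closed(1)[OF q(2)])
  also have "p - q + const c * (Poly_Mapping.single t 1 - Poly_Mapping.single t' 1)
      = p + Poly_Mapping.single t c - (q + Poly_Mapping.single t' c)"
    by (simp add: const_def right_diff_distrib mult_single)
  finally have "p + Poly_Mapping.single t c - (q + Poly_Mapping.single t' c) \<in> I" .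
  moreover have "Poly_Mapping.keys (q + Poly_Mapping.single t' c)
      \<subseteq> (\<Union>d\<in>mon_degree ` Poly_Mapping.keys (p + Poly_Mapping.single t c). chain_monomials \<kappa> V d)"
  proof
    fix s assume "s \<in> Poly_Mapping.keys (q + Poly_Mapping.single t' c)"
    then consider "s \<in> Poly_Mapping.keys q" | "s = t'"
      using subsetD[OF keys_add] by (fastforce split: if_splits)
    then show "s \<in> (\<Union>d\<in>mon_degree ` Poly_Mapping.keys (p + Poly_Mapping.single t c). chain_monomials \<kappa> V d)"
      unfolding add.hyps(3) by cases (use subsetD[OF q(1)] t'(1) in simp_all)
  qed
  ultimately show ?case by blast
qed

text \<open>Distinct chain monomials have distinct toric images, so the coefficients can be read off from the
image, which is zero.\<close>

lemma chain_polynomial_in_ideal: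
  assumes q: "q \<in> I" and keys: "Poly_Mapping.keys q \<subseteq> (\<Union>d. chain_monomials \<kappa> V d)"
  shows "q = 0"
proof (rule poly_mapping_eqI)
  fix t
  have inj_marginal: "s = t" if "s \<in> Poly_Mapping.keys q" "t \<in> Poly_Mapping.keys q" "marginal s = marginal t" for s t
  proof (rule chain_monomial_determined_by_marginal[OF _ _ _ that(3)])
    have st: "s \<in> (\<Union>d. chain_monomials \<kappa> V d)" "t \<in> (\<Union>d. chain_monomials \<kappa> V d)" using that keys by blast+
    then show "is_chain \<kappa> (Poly_Mapping.keys s)" "is_chain \<kappa> (Poly_Mapping.keys t)"
      by (auto simp: chain_monomials_def)
    show "inj_on \<kappa> (fst ` (Poly_Mapping.keys s \<union> Poly_Mapping.keys t))"
      by (rule inj_on_subset[OF inj]) (use st in \<open>auto simp: chain_monomials_def\<close>)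
  qed
  have toric_q: "toric {} q = (\<Sum>s\<in>Poly_Mapping.keys q. Poly_Mapping.single (marginal s) (Poly_Mapping.lookup q s))"
    by (simp add: toric_def linear_ext_def toric_weight_def mult_single)
  show "Poly_Mapping.lookup q t = Poly_Mapping.lookup 0 t"
  proof (cases "t \<in> Poly_Mapping.keys q")
    case True
    have "0 = Poly_Mapping.lookup (toric {} q) (marginal t)"
      using polyomino_ideal_toric[OF q] by simp
    also have "\<dots> = (\<Sum>s\<in>Poly_Mapping.keys q. if s = t then Poly_Mapping.lookup q s else 0)"
      unfolding toric_q lookup_sum using inj_marginal[OF _ True]
      by (intro sum.cong) (auto simp: lookup_single when_def)
    also have "\<dots> = Poly_Mapping.lookup q t" using True by simp
    finally show ?thesis by simp
  qed (simp add: in_keys_iff)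
qed

subsection \<open>The Hilbert series\<close>

abbreviation "S \<equiv> poly_ring V :: 'k mpoly ring"
abbreviation "R \<equiv> coord_ring P :: 'k mpoly set ring"
abbreviation \<rho> :: "'k mpoly \<Rightarrow> 'k mpoly set" where "\<rho> \<equiv> residue_class P"

lemma residue_hom: "ring_hom_ring S R \<rho>"
  using ideal.rcos_ring_hom_ring[OF polyomino_ideal_ideal]
  by (simp add: coord_ring_def residue_class_def [abs_def])

sublocale residue: ring_hom_ring S R \<rho>
  by (rule residue_hom)

lemma residue_eq_iff:
  assumes "p \<in> polys_in V" "q \<in> polys_in V"
  shows "\<rho> p = \<rho> q \<longleftrightarrow> p - q \<in> I"
  using residue.R.quotient_eq_iff_same_a_r_cos[OF polyomino_ideal_ideal, of p q] assms
  by (simp add: poly_ring_minus residue_class_def)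

lemma residue_add: "p \<in> polys_in V \<Longrightarrow> q \<in> polys_in V \<Longrightarrow> \<rho> (p + q) = \<rho> p \<oplus>\<^bsub>R\<^esub> \<rho> q"
  using residue.hom_add[of p q] by (simp add: poly_ring_eq)

lemma residue_mult: "p \<in> polys_in V \<Longrightarrow> q \<in> polys_in V \<Longrightarrow> \<rho> (p * q) = \<rho> p \<otimes>\<^bsub>R\<^esub> \<rho> q"
  using residue.hom_mult[of p q] by (simp add: poly_ring_eq)

lemma residue_0: "\<rho> 0 = \<zero>\<^bsub>R\<^esub>"
  using residue.hom_zero by (simp add: poly_ring_eq)

lemma residue_1: "\<rho> 1 = \<one>\<^bsub>R\<^esub>"
  using residue.hom_one by (simp add: poly_ring_eq)

lemma one_notin_ideal: "1 \<notin> I"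
  using polyomino_ideal_toric[of "1 :: 'k mpoly" P "{}"] by auto

lemma subfield_scalars: "subfield (coord_scalars P) R"
proof -
  have "\<one>\<^bsub>R\<^esub> \<noteq> \<zero>\<^bsub>R\<^esub>"
    using residue_eq_iff[of 1 0] one_notin_ideal by (simp add: residue_0 residue_1)
  then show ?thesis
    unfolding coord_scalars_def using residue.img_is_subfield(2)[OF subfield_const] by blast
qed

text \<open>The span of the residue classes grows by one dimension with each further chain monomial, by their
independence.\<close>

lemma dimension_chain_span:
  assumes "finite T" "T \<subseteq> (\<Union>d. chain_monomials \<kappa> V d)"
  shows "ring.dimension R (card T) (coord_scalars P) (\<rho> ` {p. Poly_Mapping.keys p \<subseteq> T})"
  using assms
proof (induction T rule: finite_induct)
  case empty
  have "\<rho> ` {p. Poly_Mapping.keys p \<subseteq> {}} = {\<zero>\<^bsub>R\<^esub>}"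
    using residue_0 by auto
  then show ?case using residue.S.dimension.zero_dim by simp
next
  case (insert t T)
  let ?E = "\<rho> ` {p. Poly_Mapping.keys p \<subseteq> T}"
  have sub: "p \<in> polys_in V" if "Poly_Mapping.keys p \<subseteq> insert t T" for p :: "'k mpoly"
    using that insert.prems unfolding polys_in_def chain_monomials_def by fast
  have t: "Poly_Mapping.single t c \<in> polys_in V" for c :: 'k by (rule sub) simp
  have "\<rho> (Poly_Mapping.single t 1) \<notin> ?E"
  proof
    assume "\<rho> (Poly_Mapping.single t 1) \<in> ?E"
    then obtain p where p: "Poly_Mapping.keys p \<subseteq> T" "\<rho> (Poly_Mapping.single t 1) = \<rho> p" by blast
    then have "Poly_Mapping.single t 1 - p \<in> I"
      using residue_eq_iff[OF t sub[of p]] by auto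
    moreover have "Poly_Mapping.keys (Poly_Mapping.single t 1 - p) \<subseteq> insert t T"
      using keys_diff[of "Poly_Mapping.single t 1" p] p(1) by auto
    ultimately have "Poly_Mapping.single t 1 - p = 0"
      by (intro chain_polynomial_in_ideal subset_trans[OF _ insert.prems])
    then have "Poly_Mapping.keys p = {t}" by (metis eq_iff_diff_eq_0 keys_single zero_neq_one)
    then show False using p(1) insert.hyps(2) by simp
  qed
  moreover have "residue.S.line_extension (coord_scalars P) (\<rho> (Poly_Mapping.single t 1)) ?E
      = \<rho> ` {p. Poly_Mapping.keys p \<subseteq> insert t T}"
  proof (intro equalityI subsetI)
    fix x assume "x \<in> residue.S.line_extension (coord_scalars P) (\<rho> (Poly_Mapping.single t 1)) ?E"
    then obtain c p where p: "Poly_Mapping.keys p \<subseteq> T"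
      and x: "x = \<rho> (const c) \<otimes>\<^bsub>R\<^esub> \<rho> (Poly_Mapping.single t 1) \<oplus>\<^bsub>R\<^esub> \<rho> p"
      unfolding residue.S.line_extension_mem_iff coord_scalars_def by blast
    have "x = \<rho> (const c * Poly_Mapping.single t 1 + p)"
      unfolding x using t sub[of p] p
      by (simp add: residue_add residue_mult polys_in_mult subset_insertI2)
    moreover have "Poly_Mapping.keys (const c * Poly_Mapping.single t 1 + p) \<subseteq> insert t T"
      using keys_add[of "const c * Poly_Mapping.single t 1" p] p
      by (auto simp: const_def mult_single split: if_splits)
    ultimately show "x \<in> \<rho> ` {p. Poly_Mapping.keys p \<subseteq> insert t T}" by blast
  next
    fix x assume "x \<in> \<rho> ` {p. Poly_Mapping.keys p \<subseteq> insert t T}"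
    then obtain p where p: "Poly_Mapping.keys p \<subseteq> insert t T" "x = \<rho> p" by blast
    define c where "c = Poly_Mapping.lookup p t"
    define q where "q = p - Poly_Mapping.single t c"
    have keys_q: "Poly_Mapping.keys q \<subseteq> T"
      using p(1) by (auto simp: q_def c_def in_keys_iff lookup_minus lookup_single when_def split: if_splits)
    have "p = const c * Poly_Mapping.single t 1 + q"
      by (simp add: q_def const_def mult_single)
    then have "x = \<rho> (const c) \<otimes>\<^bsub>R\<^esub> \<rho> (Poly_Mapping.single t 1) \<oplus>\<^bsub>R\<^esub> \<rho> q"
      unfolding p(2) using t sub[of q] keys_q
      by (simp add: residue_add residue_mult polys_in_mult subset_insertI2)
    then show "x \<in> residue.S.line_extension (coord_scalars P) (\<rho> (Poly_Mapping.single t 1)) ?E"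
      unfolding residue.S.line_extension_mem_iff coord_scalars_def using keys_q by blast
  qed
  moreover have "\<rho> (Poly_Mapping.single t 1) \<in> carrier R" using t by simp
  moreover have "residue.S.dimension (card T) (coord_scalars P) ?E" using insert by blast
  ultimately show ?case
    using residue.S.dimension.Suc_dim[of "\<rho> (Poly_Mapping.single t 1)" ?E "card T" "coord_scalars P"]
    by (simp add: insert.hyps)
qed

lemma coord_component_eq:
  "(coord_component P d :: 'k mpoly set set) = \<rho> ` {p. Poly_Mapping.keys p \<subseteq> chain_monomials \<kappa> V d}"
proof (intro equalityI subsetI)
  fix x :: "'k mpoly set" assume "x \<in> coord_component P d"
  then obtain p where p: "p \<in> polys_in V" "\<forall>t\<in>Poly_Mapping.keys p. mon_degree t = d" "x = \<rho> p"
    unfolding coord_component_def poly_component_def by auto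
  obtain q where q: "Poly_Mapping.keys q \<subseteq> (\<Union>d\<in>mon_degree ` Poly_Mapping.keys p. chain_monomials \<kappa> V d)"
    "p - q \<in> I" using normal_form[OF p(1)] by blast
  have keys_q: "Poly_Mapping.keys q \<subseteq> chain_monomials \<kappa> V d" using q(1) p(2) by fast
  then have "q \<in> polys_in V" unfolding polys_in_def chain_monomials_def by blast
  then have "x = \<rho> q" using residue_eq_iff[OF p(1)] q(2) p(3) by simp
  then show "x \<in> \<rho> ` {p. Poly_Mapping.keys p \<subseteq> chain_monomials \<kappa> V d}" using keys_q by blast
next
  fix x assume "x \<in> \<rho> ` {p. Poly_Mapping.keys p \<subseteq> chain_monomials \<kappa> V d}"
  then obtain p where p: "Poly_Mapping.keys p \<subseteq> chain_monomials \<kappa> V d" "x = \<rho> p" by blast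
  then have "p \<in> poly_component V d"
    unfolding poly_component_def chain_monomials_def carrier_poly_ring polys_in_def by blast
  then show "x \<in> coord_component P d" unfolding coord_component_def p(2) by (rule imageI)
qed

theorem hilbert_series_eq:
  "hilbert_series R (coord_scalars P) (coord_component P) = chain_series \<kappa> V"
proof -
  have "residue.S.dim (coord_scalars P) (coord_component P d) = card (chain_monomials \<kappa> V d)" for d
    using residue.S.dimI[OF subfield_scalars dimension_chain_span[of "chain_monomials \<kappa> V d"]] fin
    unfolding coord_component_eq over_def by auto
  then show ?thesis by (simp add: hilbert_series_def chain_series_def)
qed

end

section \<open>The Krull dimension\<close>

text \<open>A homogeneous linear system with more unknowns than equations, by Gaussian elimination.\<close>

lemma exists_nontrivial_relation:
  fixes M :: "'a \<Rightarrow> 'b \<Rightarrow> 'k::field"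
  assumes "finite T" "finite A" "card T < card A"
  shows "\<exists>c. (\<exists>a\<in>A. c a \<noteq> 0) \<and> (\<forall>t\<in>T. (\<Sum>a\<in>A. c a * M a t) = 0)"
  using assms
proof (induction T arbitrary: A M rule: finite_induct)
  case empty
  then obtain a where "a \<in> A" by fastforce
  then show ?case by (intro exI[of _ "\<lambda>_. 1"]) auto
next
  case (insert t T)
  show ?case
  proof (cases "\<forall>a\<in>A. M a t = 0")
    case True
    obtain c where "\<exists>a\<in>A. c a \<noteq> 0" "\<forall>t\<in>T. (\<Sum>a\<in>A. c a * M a t) = 0"
      using insert.IH[of A M] insert.prems insert.hyps by auto
    then show ?thesis using True by (intro exI[of _ c]) simp
  next
    case False
    then obtain a\<^sub>0 where a0: "a\<^sub>0 \<in> A" "M a\<^sub>0 t \<noteq> 0" by blast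
    define A' where "A' = A - {a\<^sub>0}"
    \<comment> \<open>Row \<open>a\<^sub>0\<close> serves as pivot to clear column \<open>t\<close>.\<close>
    define M' where "M' a s = M a s - M a t / M a\<^sub>0 t * M a\<^sub>0 s" for a s
    have A: "A = insert a\<^sub>0 A'" "a\<^sub>0 \<notin> A'" "finite A'" using a0 insert.prems by (auto simp: A'_def)
    have "card T < card A'" using insert.prems insert.hyps A by simp
    then obtain c where c: "\<exists>a\<in>A'. c a \<noteq> 0" "\<forall>s\<in>T. (\<Sum>a\<in>A'. c a * M' a s) = 0"
      using insert.IH[of A' M'] A(3) by blast
    define d where "d a = (if a = a\<^sub>0 then - (\<Sum>a\<in>A'. c a * M a t) / M a\<^sub>0 t else c a)" for a
    have d_sum: "(\<Sum>a\<in>A. d a * M a s) = (\<Sum>a\<in>A'. c a * M' a s)" for s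
    proof -
      have "(\<Sum>a\<in>A. d a * M a s) = d a\<^sub>0 * M a\<^sub>0 s + (\<Sum>a\<in>A'. c a * M a s)"
        unfolding A(1) using A(2,3) by (auto simp: d_def intro!: sum.cong)
      also have "d a\<^sub>0 * M a\<^sub>0 s = - (\<Sum>a\<in>A'. c a * (M a t / M a\<^sub>0 t * M a\<^sub>0 s))"
        by (simp add: d_def sum_distrib_right sum_divide_distrib mult.assoc)
      finally show ?thesis
        by (simp add: M'_def right_diff_distrib sum_subtractf)
    qed
    have "M' a t = 0" for a using a0(2) by (simp add: M'_def)
    then have "\<forall>s\<in>insert t T. (\<Sum>a\<in>A. d a * M a s) = 0"
      using c(2) unfolding d_sum by simp
    moreover have "\<exists>a\<in>A. d a \<noteq> 0" using c(1) A by (auto simp: d_def)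
    ultimately show ?thesis by blast
  qed
qed

text \<open>Multiplying by \<open>1 - t\<close> takes differences, so the partial sums of \<open>G (1 - t)\<close> are the coefficients
of \<open>G\<close>: each factor costs one degree of growth.\<close>

lemma coefficient_sums_bounded:
  fixes G :: "int fps"
  assumes "G * (1 - fps_X) ^ d = fps_of_poly Q"
  shows "\<exists>C::nat. \<forall>M. \<bar>\<Sum>k\<le>M. fps_nth G k\<bar> \<le> int C * int (M + 1) ^ d"
  using assms
proof (induction d arbitrary: G)
  case 0
  define C where "C = (\<Sum>k\<le>degree Q. \<bar>coeff Q k\<bar>)"
  have "\<bar>\<Sum>k\<le>M. fps_nth G k\<bar> \<le> C" for M
  proof -
    have "\<bar>\<Sum>k\<le>M. fps_nth G k\<bar> \<le> (\<Sum>k\<le>M. \<bar>coeff Q k\<bar>)"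
      using 0 sum_abs[of "coeff Q" "{..M}"] by simp
    also have "\<dots> = (\<Sum>k\<in>{..M} \<inter> {..degree Q}. \<bar>coeff Q k\<bar>)"
      by (rule sum.mono_neutral_right) (auto intro: le_degree)
    also have "\<dots> \<le> C" unfolding C_def by (rule sum_mono2) auto
    finally show ?thesis .
  qed
  moreover have "C \<ge> 0" unfolding C_def by (simp add: sum_nonneg)
  ultimately show ?case by (intro exI[of _ "nat C"]) simp
next
  case (Suc d)
  define G' where "G' = G * (1 - fps_X)"
  have "G' * (1 - fps_X) ^ d = fps_of_poly Q"
    using Suc.prems by (simp add: G'_def mult.assoc)
  then obtain C :: nat where C: "\<And>M. \<bar>\<Sum>k\<le>M. fps_nth G' k\<bar> \<le> int C * int (M + 1) ^ d"
    using Suc.IH by blast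
  have "(\<Sum>k\<le>M. fps_nth G' k) = fps_nth G M" for M
    by (induction M) (simp_all add: G'_def right_diff_distrib)
  then have G: "\<bar>fps_nth G M\<bar> \<le> int C * int (M + 1) ^ d" for M using C[of M] by simp
  have "\<bar>\<Sum>k\<le>M. fps_nth G k\<bar> \<le> int C * int (M + 1) ^ Suc d" for M
  proof -
    have "\<bar>\<Sum>k\<le>M. fps_nth G k\<bar> \<le> (\<Sum>k\<le>M. \<bar>fps_nth G k\<bar>)" by (rule sum_abs)
    also have "\<dots> \<le> (\<Sum>k\<le>M. int C * int (M + 1) ^ d)"
    proof (rule sum_mono)
      fix k assume "k \<in> {..M}"
      then have "int C * int (k + 1) ^ d \<le> int C * int (M + 1) ^ d"
        by (intro mult_left_mono power_mono) auto
      then show "\<bar>fps_nth G k\<bar> \<le> int C * int (M + 1) ^ d" using G[of k] by linarith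
    qed
    also have "\<dots> = int C * int (M + 1) ^ Suc d" by (simp add: algebra_simps)
    finally show ?thesis .
  qed
  then show ?case by blast
qed

subsection \<open>Chains of prime ideals\<close>

lemma primeideal_poly_ringD:
  fixes J :: "'k::field mpoly set"
  assumes "primeideal J (poly_ring V)"
  shows "J \<subseteq> polys_in V" "0 \<in> J" "\<And>p q. p \<in> J \<Longrightarrow> q \<in> J \<Longrightarrow> p - q \<in> J"
    "\<And>p r. p \<in> J \<Longrightarrow> r \<in> polys_in V \<Longrightarrow> p * r \<in> J"
    "\<And>p q. p * q \<in> J \<Longrightarrow> p \<in> polys_in V \<Longrightarrow> q \<in> polys_in V \<Longrightarrow> p \<in> J \<or> q \<in> J"
    "\<And>c. const c \<in> J \<Longrightarrow> c = 0"
proof -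
  interpret J: primeideal J "poly_ring V :: 'k mpoly ring" by fact
  show sub: "J \<subseteq> polys_in V" using J.a_subset by simp
  show "0 \<in> J"
    using additive_subgroup.zero_closed[OF J.additive_subgroup_axioms] by (simp add: poly_ring_eq)
  show mult: "p * r \<in> J" if "p \<in> J" "r \<in> polys_in V" for p r
    using J.I_r_closed[OF that(1)] that(2) by (simp add: poly_ring_eq)
  show "p - q \<in> J" if "p \<in> J" "q \<in> J" for p q
  proof -
    have "q * (- 1) \<in> J" using that(2) by (rule mult) (rule polys_in_uminus, simp)
    then have "p + q * (- 1) \<in> J"
      using additive_subgroup.a_closed[OF J.additive_subgroup_axioms that(1), of "q * (- 1)"]
      by (simp add: poly_ring_eq)
    then show ?thesis by simp
  qed
  show "p \<in> J \<or> q \<in> J" if "p * q \<in> J" "p \<in> polys_in V" "q \<in> polys_in V" for p q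
    using J.I_prime[of p q] that by (simp add: poly_ring_eq)
  show "c = 0" if "const c \<in> J" for c
  proof (rule ccontr)
    assume "c \<noteq> 0"
    then have "const c * const (inverse c) = (1 :: 'k mpoly)" by (simp add: const_def mult_single)
    then have one: "1 \<in> J" using mult[OF that, of "const (inverse c)"] by simp
    have "p \<in> J" if "p \<in> polys_in V" for p using mult[OF one that] by simp
    then show False using J.I_notcarr sub by auto
  qed
qed

definition exponent_lists :: "nat \<Rightarrow> nat \<Rightarrow> nat list set" where
  "exponent_lists n N = {as. set as \<subseteq> {..<N} \<and> length as = n}"

lemma exponent_lists_finite [simp]: "finite (exponent_lists n N)"
  unfolding exponent_lists_def by (rule finite_lists_length_eq) simp

lemma card_exponent_lists: "card (exponent_lists n N) = N ^ n"
  unfolding exponent_lists_def by (subst card_lists_length_eq) simp_all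

text \<open>Splitting off the first exponent presents a polynomial in several elements as a polynomial in the
first one with coefficients in the others.\<close>

lemma sum_exponent_lists_Suc:
  "(\<Sum>as\<in>exponent_lists (Suc n) N. g as) = (\<Sum>e<N. \<Sum>as\<in>exponent_lists n N. g (e # as))"
proof -
  have "(\<Sum>e<N. \<Sum>as\<in>exponent_lists n N. g (e # as)) = (\<Sum>(e, as)\<in>{..<N} \<times> exponent_lists n N. g (e # as))"
    by (simp add: sum.cartesian_product)
  also have "\<dots> = (\<Sum>as\<in>exponent_lists (Suc n) N. g as)"
    by (rule sum.reindex_bij_witness[of _ "\<lambda>as. (hd as, tl as)" "\<lambda>(e, as). e # as"])
      (auto simp: exponent_lists_def length_Suc_conv)
  finally show ?thesis by simp
qed

fun power_product :: "'a::comm_ring_1 list \<Rightarrow> nat list \<Rightarrow> 'a" where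
  "power_product (f # fs) (e # as) = f ^ e * power_product fs as"
| "power_product _ _ = 1"

lemma polys_in_power: "p \<in> polys_in V \<Longrightarrow> p ^ n \<in> polys_in V"
  by (induction n) (simp_all add: polys_in_mult)

lemma polys_in_sum: "(\<And>a. a \<in> A \<Longrightarrow> f a \<in> polys_in V) \<Longrightarrow> sum f A \<in> polys_in V"
  by (induction A rule: infinite_finite_induct) (simp_all add: polys_in_add)

lemma polys_in_power_product: "set fs \<subseteq> polys_in V \<Longrightarrow> power_product fs as \<in> polys_in V"
  by (induction fs as rule: power_product.induct) (simp_all add: polys_in_mult polys_in_power)

text \<open>Modulo \<open>J'\<close> only the constant coefficient survives, so it vanishes by assumption. The rest is
divisible by \<open>f\<close>, and the prime \<open>J\<close> permits to cancel \<open>f\<close>.\<close>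

lemma power_series_digits_vanish:
  fixes f :: "'k::field mpoly"
  assumes J: "primeideal J (poly_ring V)" "primeideal J' (poly_ring V)" "J \<subseteq> J'"
    and f: "f \<in> J'" "f \<notin> J"
    and G: "\<And>e. G e \<in> polys_in V" "\<And>e. e < N \<Longrightarrow> G e \<in> J' \<Longrightarrow> G e = 0"
    and sum: "(\<Sum>e<N. f ^ e * G e) \<in> J"
  shows "\<forall>e<N. G e = 0"
  using G sum
proof (induction N arbitrary: G)
  case (Suc N)
  note J1 = primeideal_poly_ringD[OF J(1)] and J2 = primeideal_poly_ringD[OF J(2)]
  have fV: "f \<in> polys_in V" using f J2(1) by blast
  define H where "H = (\<Sum>e<N. f ^ e * G (Suc e))"
  have HV: "H \<in> polys_in V"
    unfolding H_def using Suc.prems(1) fV by (intro polys_in_sum polys_in_mult polys_in_power)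
  have eq: "(\<Sum>e<Suc N. f ^ e * G e) = G 0 + f * H"
    by (simp add: sum.lessThan_Suc_shift H_def sum_distrib_left mult.assoc del: sum.lessThan_Suc)
  have "G 0 + f * H \<in> J" using Suc.prems(3) unfolding eq .
  then have "G 0 + f * H - f * H \<in> J'" using J(3) J2(3) J2(4)[OF f(1) HV] by blast
  then have G0: "G 0 = 0" using Suc.prems(2)[of 0] by simp
  then have "f * H \<in> J" using \<open>G 0 + f * H \<in> J\<close> by simp
  then have "H \<in> J" using J1(5) fV HV f(2) by blast
  have "\<forall>e<N. G (Suc e) = 0"
  proof (rule Suc.IH)
    show "(\<Sum>e<N. f ^ e * G (Suc e)) \<in> J" using \<open>H \<in> J\<close> unfolding H_def .
    show "G (Suc e) = 0" if "e < N" "G (Suc e) \<in> J'" for e using Suc.prems(2)[of "Suc e"] that by simp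
  qed (rule Suc.prems(1))
  then show ?case using G0 by (metis less_Suc_eq_0_disj)
qed simp

text \<open>Elements chosen in the successive differences of a chain of primes are algebraically independent
modulo the smallest prime. In the induction, the coefficients with respect to the first element
are polynomials in the others, and these are independent modulo the second prime.\<close>

lemma prime_chain_independent:
  fixes fs :: "'k::field mpoly list"
  assumes "\<And>k. k \<le> length fs \<Longrightarrow> primeideal (J k) (poly_ring V)"
    and "\<And>k. k < length fs \<Longrightarrow> J k \<subseteq> J (Suc k)"
    and "\<And>k. k < length fs \<Longrightarrow> fs ! k \<in> J (Suc k) \<and> fs ! k \<notin> J k"
    and "(\<Sum>as\<in>exponent_lists (length fs) N. const (c as) * power_product fs as) \<in> J 0"
  shows "\<forall>as\<in>exponent_lists (length fs) N. c as = 0"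
  using assms
proof (induction fs arbitrary: J c)
  case Nil
  have "exponent_lists 0 N = {[]}" by (auto simp: exponent_lists_def)
  then show ?case using Nil(4) primeideal_poly_ringD(6)[OF Nil(1)[of 0]] by simp
next
  case (Cons f fs)
  let ?L = "exponent_lists (length fs) N"
  define G where "G e = (\<Sum>as\<in>?L. const (c (e # as)) * power_product fs as)" for e
  have f: "f \<in> J 1" "f \<notin> J 0" using Cons.prems(3)[of 0] by simp_all
  have primes: "primeideal (J 0) (poly_ring V)" "primeideal (J 1) (poly_ring V)"
    using Cons.prems(1)[of 0] Cons.prems(1)[of 1] by simp_all
  have fs: "set fs \<subseteq> polys_in V"
  proof
    fix g assume "g \<in> set fs"
    then obtain k where "k < length fs" "g = fs ! k" by (metis in_set_conv_nth)
    then show "g \<in> polys_in V"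
      using Cons.prems(3)[of "Suc k"] primeideal_poly_ringD(1)[OF Cons.prems(1)[of "Suc (Suc k)"]] by auto
  qed
  have coeffs: "\<forall>as\<in>?L. c (e # as) = 0" if "G e \<in> J 1" for e
  proof (rule Cons.IH[of "\<lambda>k. J (Suc k)" "\<lambda>as. c (e # as)"])
    show "primeideal (J (Suc k)) (poly_ring V)" if "k \<le> length fs" for k
      using Cons.prems(1)[of "Suc k"] that by simp
    show "J (Suc k) \<subseteq> J (Suc (Suc k))" if "k < length fs" for k
      using Cons.prems(2)[of "Suc k"] that by simp
    show "fs ! k \<in> J (Suc (Suc k)) \<and> fs ! k \<notin> J (Suc k)" if "k < length fs" for k
      using Cons.prems(3)[of "Suc k"] that by simp
    show "(\<Sum>as\<in>?L. const (c (e # as)) * power_product fs as) \<in> J (Suc 0)"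
      using that by (simp add: G_def)
  qed
  have "\<forall>e<N. G e = 0"
  proof (rule power_series_digits_vanish[OF primes _ f])
    show "J 0 \<subseteq> J 1" using Cons.prems(2)[of 0] by simp
    show "G e \<in> polys_in V" for e
      unfolding G_def using fs by (intro polys_in_sum polys_in_mult polys_in_power_product) auto
    show "G e = 0" if "G e \<in> J 1" for e
      unfolding G_def using coeffs[OF that] by (simp add: const_def)
    show "(\<Sum>e<N. f ^ e * G e) \<in> J 0"
      using Cons.prems(4) by (simp add: sum_exponent_lists_Suc G_def sum_distrib_left mult_ac)
  qed
  then have "\<forall>as\<in>?L. c (e # as) = 0" if "e < N" for e
    using coeffs[of e] primeideal_poly_ringD(2)[OF primes(2)] that by simp
  then show ?case by (auto simp: exponent_lists_def length_Suc_conv)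
qed

definition degree_le :: "'k::field mpoly \<Rightarrow> nat \<Rightarrow> bool" where
  "degree_le p d \<longleftrightarrow> (\<forall>t\<in>Poly_Mapping.keys p. mon_degree t \<le> d)"

lemma degree_le_mult:
  assumes "degree_le p d" "degree_le q e"
  shows "degree_le (p * q) (d + e)"
  unfolding degree_le_def
proof
  fix t assume "t \<in> Poly_Mapping.keys (p * q)"
  then obtain a b where "t = a + b" "a \<in> Poly_Mapping.keys p" "b \<in> Poly_Mapping.keys q"
    using keys_mult[of p q] by blast
  then show "mon_degree t \<le> d + e"
    using assms by (simp add: degree_le_def mon_degree_add add_mono)
qed

lemma degree_le_power: "degree_le p d \<Longrightarrow> degree_le (p ^ n) (n * d)"
  by (induction n) (simp_all add: degree_le_mult, simp add: degree_le_def)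

lemma degree_le_mono: "degree_le p d \<Longrightarrow> d \<le> e \<Longrightarrow> degree_le p e"
  by (auto simp: degree_le_def)

lemma degree_le_power_product:
  assumes "\<And>f. f \<in> set fs \<Longrightarrow> degree_le f D" "set as \<subseteq> {..<N}"
  shows "degree_le (power_product fs as) (length fs * (N * D))"
  using assms
proof (induction fs as rule: power_product.induct)
  case (1 f fs e as)
  have "degree_le (f ^ e) (N * D)"
    by (rule degree_le_mono[OF degree_le_power[of f D e]]) (use 1 in auto)
  moreover have "degree_le (power_product fs as) (length fs * (N * D))" using 1 by simp
  ultimately show ?case using degree_le_mult by fastforce
qed (simp_all add: degree_le_def)

lemma exists_degree_bound: "\<exists>D. \<forall>f\<in>set fs. degree_le f D"
proof (induction fs)
  case (Cons f fs)
  then obtain D where D: "\<forall>f\<in>set fs. degree_le f D" by blast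
  define E where "E = Max (insert 0 (mon_degree ` Poly_Mapping.keys f))"
  have "degree_le f E" unfolding degree_le_def E_def by simp
  then have "\<forall>g\<in>set (f # fs). degree_le g (max D E)"
    using D degree_le_mono[of _ D "max D E"] degree_le_mono[of f E "max D E"] by auto
  then show ?case by blast
qed simp

context ferrers_polyomino
begin

lemma carrier_coord_ring: "carrier R = \<rho> ` polys_in V"
  unfolding coord_ring_def FactRing_def A_RCOSETS_def' residue_class_def by auto

lemma cring_coord_ring: "cring R"
  unfolding coord_ring_def by (rule ideal.quotient_is_cring[OF polyomino_ideal_ideal cring_poly_ring])

text \<open>The \<open>N^n\<close> monomials in \<open>f\<^sub>1, \<dots>, f\<^sub>n\<close> with exponents below \<open>N\<close> have degree at most \<open>n N E\<close>, so their
normal forms live in a space of dimension \<open>O(N^D)\<close>. For \<open>n > D\<close> and large \<open>N\<close> there is a linear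
relation between them, contrary to their independence.\<close>

lemma prime_chain_length_le:
  assumes growth: "\<And>M. (\<Sum>d\<le>M. card (chain_monomials \<kappa> V d)) \<le> C * (M + 1) ^ D"
    and primes: "\<And>i. i \<le> n \<Longrightarrow> primeideal (\<pp> i) R"
    and strict: "\<And>i. i < n \<Longrightarrow> \<pp> i \<subset> \<pp> (Suc i)"
  shows "n \<le> D"
proof (rule ccontr)
  assume "\<not> n \<le> D"
  then have n: "D < n" by simp
  define J where "J i = {p \<in> polys_in V. \<rho> p \<in> \<pp> i}" for i
  have J: "primeideal (J i) S" if "i \<le> n" for i
    using residue.primeideal_vimage[OF cring_poly_ring primes[OF that]] by (simp add: J_def)
  have "\<exists>f. f \<in> J (Suc i) \<and> f \<notin> J i" if i: "i < n" for i
  proof -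
    obtain x where x: "x \<in> \<pp> (Suc i)" "x \<notin> \<pp> i" using strict[OF i] by blast
    have "ideal (\<pp> (Suc i)) R" using primes[of "Suc i"] i by (simp add: primeideal_def)
    then have "\<pp> (Suc i) \<subseteq> carrier R"
      by (simp add: additive_subgroup.a_subset ideal.axioms(1))
    then obtain f where "f \<in> polys_in V" "x = \<rho> f" using x(1) carrier_coord_ring by blast
    then show ?thesis using x by (auto simp: J_def)
  qed
  then obtain g where g: "\<And>i. i < n \<Longrightarrow> g i \<in> J (Suc i) \<and> g i \<notin> J i" by metis
  define fs where "fs = map g [0..<n]"
  have len: "length fs = n" and nth: "\<And>k. k < n \<Longrightarrow> fs ! k = g k" by (simp_all add: fs_def)
  have fsV: "set fs \<subseteq> polys_in V" using g by (auto simp: fs_def J_def)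
  obtain E where E: "\<And>f. f \<in> set fs \<Longrightarrow> degree_le f E" using exists_degree_bound by blast
  \<comment> \<open>Just large enough for \<open>C (M + 1)^D < N^(D + 1)\<close>, as \<open>M + 1 \<le> (n E + 1) N\<close>.\<close>
  define N where "N = C * (n * E + 1) ^ D + 1"
  define M where "M = n * (N * E)"
  define T where "T = (\<Union>d\<le>M. chain_monomials \<kappa> V d)"
  have finT: "finite T" using fin by (simp add: T_def)
  have "card T \<le> (\<Sum>d\<le>M. card (chain_monomials \<kappa> V d))"
    unfolding T_def by (rule card_UN_le) simp
  also have "\<dots> \<le> C * (M + 1) ^ D" by (rule growth)
  also have "\<dots> \<le> C * ((n * E + 1) * N) ^ D"
  proof (intro mult_left_mono power_mono)
    have "1 \<le> N" by (simp add: N_def)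
    then show "M + 1 \<le> (n * E + 1) * N" by (simp add: M_def algebra_simps)
  qed simp_all
  also have "\<dots> = (C * (n * E + 1) ^ D) * N ^ D" by (simp only: power_mult_distrib mult.assoc)
  also have "\<dots> < N * N ^ D" by (intro mult_strict_right_mono) (simp_all add: N_def)
  also have "\<dots> = N ^ Suc D" by simp
  also have "\<dots> \<le> N ^ n" by (rule power_increasing) (use n in \<open>simp_all add: N_def\<close>)
  also have "\<dots> = card (exponent_lists n N)" by (simp add: card_exponent_lists)
  finally have card: "card T < card (exponent_lists n N)" .
  have "\<exists>q. Poly_Mapping.keys q \<subseteq> T \<and> power_product fs as - q \<in> I" if "as \<in> exponent_lists n N" for as
  proof -
    have deg: "degree_le (power_product fs as) M"
      using degree_le_power_product[of fs E as N, OF E] that by (simp add: M_def len exponent_lists_def)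
    obtain q where q: "Poly_Mapping.keys q \<subseteq>
        (\<Union>d\<in>mon_degree ` Poly_Mapping.keys (power_product fs as). chain_monomials \<kappa> V d)"
      "power_product fs as - q \<in> I" using normal_form[OF polys_in_power_product[OF fsV]] by blast
    have "(\<Union>d\<in>mon_degree ` Poly_Mapping.keys (power_product fs as). chain_monomials \<kappa> V d) \<subseteq> T"
      unfolding T_def by (rule UN_mono) (use deg in \<open>auto simp: degree_le_def\<close>)
    with q(1) have "Poly_Mapping.keys q \<subseteq> T" by (rule subset_trans)
    then show ?thesis using q(2) by blast
  qed
  then obtain q where q: "\<And>as. as \<in> exponent_lists n N \<Longrightarrow> Poly_Mapping.keys (q as) \<subseteq> T"
    "\<And>as. as \<in> exponent_lists n N \<Longrightarrow> power_product fs as - q as \<in> I" by metis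
  obtain c :: "nat list \<Rightarrow> 'k" where c: "\<exists>as\<in>exponent_lists n N. c as \<noteq> 0"
    "\<forall>t\<in>T. (\<Sum>as\<in>exponent_lists n N. c as * Poly_Mapping.lookup (q as) t) = 0"
    using exists_nontrivial_relation[OF finT _ card, of "\<lambda>as t. Poly_Mapping.lookup (q as) t"] by auto
  have lookup_const: "Poly_Mapping.lookup (const a * p) t = a * Poly_Mapping.lookup p t" for a :: 'k and p t
    by (simp add: const_def Poly_Mapping.map.rep_eq flip: mult_map_scale_conv_mult) (simp add: when_def)
  have q0: "(\<Sum>as\<in>exponent_lists n N. const (c as) * q as) = 0"
  proof (rule poly_mapping_eqI)
    fix t
    have "(\<Sum>as\<in>exponent_lists n N. c as * Poly_Mapping.lookup (q as) t) = 0"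
    proof (cases "t \<in> T")
      case False
      then have "Poly_Mapping.lookup (q as) t = 0" if "as \<in> exponent_lists n N" for as
        using q(1)[OF that] by (auto simp: in_keys_iff)
      then show ?thesis by simp
    qed (use c(2) in blast)
    then show "Poly_Mapping.lookup (\<Sum>as\<in>exponent_lists n N. const (c as) * q as) t = Poly_Mapping.lookup 0 t"
      by (simp add: lookup_sum lookup_const)
  qed
  have in_I: "(\<Sum>as\<in>A. const (c as) * (power_product fs as - q as)) \<in> I" if "A \<subseteq> exponent_lists n N" for A
  proof -
    have "finite A" using that finite_subset by fastforce
    then show ?thesis
      using that
    proof (induction A rule: finite_induct)
      case empty
      then show ?case by (simp add: polyomino_ideal_closed(4))
    next
      case (insert as A)
      have "const (c as) * (power_product fs as - q as) \<in> I"
        by (rule polyomino_ideal_closed(2)) (use insert.prems q(2) in auto)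
      then show ?case using insert polyomino_ideal_closed(1) by simp
    qed
  qed
  have IJ: "I \<subseteq> J 0"
  proof
    fix p assume p: "p \<in> I"
    have pV: "p \<in> polys_in V"
      using p additive_subgroup.a_subset[OF ideal.axioms(1)[OF polyomino_ideal_ideal]] by fastforce
    have "\<rho> p = \<rho> 0" using residue_eq_iff[OF pV polys_in_0] p by simp
    moreover have "\<zero>\<^bsub>R\<^esub> \<in> \<pp> 0"
      using primes[of 0] by (simp add: primeideal_def ideal_def additive_subgroup.zero_closed)
    ultimately show "p \<in> J 0" using pV by (simp add: J_def residue_0)
  qed
  have "(\<Sum>as\<in>exponent_lists n N. const (c as) * power_product fs as)
      = (\<Sum>as\<in>exponent_lists n N. const (c as) * (power_product fs as - q as))"
    using q0 by (simp add: right_diff_distrib sum_subtractf)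
  then have sum_J: "(\<Sum>as\<in>exponent_lists (length fs) N. const (c as) * power_product fs as) \<in> J 0"
    using in_I[of "exponent_lists n N"] IJ unfolding len by auto
  have "\<forall>as\<in>exponent_lists (length fs) N. c as = 0"
  proof (rule prime_chain_independent[where J = J and V = V])
    show "(\<Sum>as\<in>exponent_lists (length fs) N. const (c as) * power_product fs as) \<in> J 0"
      by (rule sum_J)
    show "primeideal (J k) (poly_ring V)" if "k \<le> length fs" for k using J that len by simp
    show "J k \<subseteq> J (Suc k)" if "k < length fs" for k
      using strict[of k] that len by (auto simp: J_def)
    show "fs ! k \<in> J (Suc k) \<and> fs ! k \<notin> J k" if "k < length fs" for k
      using g[of k] nth[of k] that len by simp
  qed
  then show False using c(1) len by blast
qed

end


subsection \<open>Prime ideals from the toric map\<close>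

text \<open>Setting variables to zero after the toric map deletes the terms that contain one of them; in this
form the kernels are visibly increasing in \<open>A\<close>.\<close>

lemma toric_weight_marginal:
  "toric_weight A t = (if Poly_Mapping.keys (marginal t) \<inter> A = {} then Poly_Mapping.single (marginal t) 1 else 0)"
  unfolding toric_weight_def keys_marginal by (rule if_cong) auto

lemma lookup_toric:
  "Poly_Mapping.lookup (toric A p) m =
     (if Poly_Mapping.keys m \<inter> A = {} then Poly_Mapping.lookup (toric {} p) m else 0)"
proof (induction p rule: poly_mapping_add_induct)
  case (add p t c)
  have "Poly_Mapping.lookup (toric A (Poly_Mapping.single t c)) m =
     (if Poly_Mapping.keys m \<inter> A = {} then Poly_Mapping.lookup (toric {} (Poly_Mapping.single t c)) m else 0)"
    by (auto simp: toric_def toric_weight_marginal mult_single lookup_single when_def)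
  then show ?case using add by (simp add: toric_add lookup_add)
qed simp

lemma toric_eq_0_mono:
  assumes "A \<subseteq> B" "toric A p = 0"
  shows "toric B p = 0"
proof (rule poly_mapping_eqI)
  fix m
  have "Poly_Mapping.lookup (toric A p) m = 0" using assms(2) by simp
  then show "Poly_Mapping.lookup (toric B p) m = Poly_Mapping.lookup 0 m"
    using assms(1) by (auto simp: lookup_toric[of A] lookup_toric[of B] split: if_splits)
qed

context ferrers_polyomino
begin

text \<open>The kernel of the map that the coordinate ring inherits from \<open>toric A\<close>.\<close>

definition toric_prime :: "nat set \<Rightarrow> 'k mpoly set set" where
  "toric_prime A = \<rho> ` {p \<in> polys_in V. toric A p = 0}"

lemma residue_in_toric_prime:
  assumes "p \<in> polys_in V"
  shows "\<rho> p \<in> toric_prime A \<longleftrightarrow> toric A p = 0"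
proof
  assume "\<rho> p \<in> toric_prime A"
  then obtain q where q: "q \<in> polys_in V" "toric A q = 0" "\<rho> p = \<rho> q"
    unfolding toric_prime_def by blast
  then have "toric A (p - q) = 0"
    using residue_eq_iff[OF assms q(1)] polyomino_ideal_toric by blast
  then show "toric A p = 0" using q(2) by (simp add: toric_diff)
qed (use assms in \<open>auto simp: toric_prime_def\<close>)

text \<open>The preimage of the zero ideal of a domain. The induced map evaluates an arbitrary representative.\<close>

lemma primeideal_toric_prime: "primeideal (toric_prime A) R"
proof -
  define h where "h X = toric A (SOME p. p \<in> polys_in V \<and> \<rho> p = X)" for X
  have h: "h (\<rho> p) = toric A p" if p: "p \<in> polys_in V" for p
  proof -
    define q where "q = (SOME q. q \<in> polys_in V \<and> \<rho> q = \<rho> p)"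
    have "q \<in> polys_in V \<and> \<rho> q = \<rho> p" unfolding q_def by (rule someI[of _ p]) (use p in simp)
    then have "p - q \<in> I" using residue_eq_iff[OF p, of q] by auto
    then have "toric A (p - q) = 0" by (rule polyomino_ideal_toric)
    then show ?thesis by (simp add: h_def q_def toric_diff)
  qed
  have dom: "domain (type_ring (UNIV :: 'k torus set))" by (rule domain_type_ring_UNIV)
  interpret T: "domain" "type_ring (UNIV :: 'k torus set)" by (rule dom)
  have "ring_hom_ring R (type_ring UNIV) h"
  proof (rule ring_hom_ringI)
    fix x y assume "x \<in> carrier R" "y \<in> carrier R"
    then obtain p q where pq: "p \<in> polys_in V" "q \<in> polys_in V" "x = \<rho> p" "y = \<rho> q"
      unfolding carrier_coord_ring by blast
    show "h (x \<otimes>\<^bsub>R\<^esub> y) = h x \<otimes>\<^bsub>type_ring UNIV\<^esub> h y"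
      unfolding pq(3,4) residue_mult[OF pq(1,2), symmetric]
      using pq(1,2) by (simp add: h polys_in_mult toric_mult)
    show "h (x \<oplus>\<^bsub>R\<^esub> y) = h x \<oplus>\<^bsub>type_ring UNIV\<^esub> h y"
      unfolding pq(3,4) residue_add[OF pq(1,2), symmetric]
      using pq(1,2) by (simp add: h polys_in_add toric_add)
  next
    show "h \<one>\<^bsub>R\<^esub> = \<one>\<^bsub>type_ring UNIV\<^esub>"
      unfolding residue_1[symmetric] by (simp add: h)
  qed (use residue.S.ring_axioms T.ring_axioms in simp_all)
  then have "primeideal {x \<in> carrier R. h x \<in> {\<zero>\<^bsub>type_ring UNIV\<^esub>}} R"
    by (rule ring_hom_ring.primeideal_vimage[OF _ cring_coord_ring T.zeroprimeideal])
  moreover have "{x \<in> carrier R. h x \<in> {\<zero>\<^bsub>type_ring UNIV\<^esub>}} = toric_prime A"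
    unfolding carrier_coord_ring toric_prime_def using h by auto
  ultimately show ?thesis by simp
qed

lemma toric_prime_strict:
  assumes "A \<subseteq> B" "v \<in> V" "nodes v \<inter> A = {}" "nodes v \<inter> B \<noteq> {}"
  shows "toric_prime A \<subset> toric_prime B"
proof -
  have v: "var v \<in> (polys_in V :: 'k mpoly set)" using assms(2) by (simp add: var_def polys_in_single)
  have "Poly_Mapping.single m (1 :: 'k) \<noteq> 0" for m :: "nat \<Rightarrow>\<^sub>0 nat"
    by (metis lookup_single_eq lookup_zero one_neq_zero)
  then have "toric B (var v :: 'k mpoly) = 0" "toric A (var v :: 'k mpoly) \<noteq> 0"
    unfolding toric_var using assms(3,4) by (simp_all only: if_True if_False simp_thms)
  then have "\<rho> (var v) \<in> toric_prime B" "\<rho> (var v) \<notin> toric_prime A"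
    by (simp_all only: residue_in_toric_prime[OF v] simp_thms)
  moreover have "toric_prime A \<subseteq> toric_prime B"
    unfolding toric_prime_def using toric_eq_0_mono[OF assms(1)] by blast
  ultimately show ?thesis by blast
qed

text \<open>Killing one more node enlarges the prime strictly as soon as some vertex at that node is still
alive.\<close>

lemma krull_dim_ge_node_sequence:
  assumes "\<And>k. k < length xs \<Longrightarrow> \<exists>v\<in>V. xs ! k \<in> nodes v \<and> nodes v \<inter> set (take k xs) = {}"
  shows "enat (length xs) \<le> krull_dim R"
  unfolding krull_dim_def
proof (rule Sup_upper, intro CollectI exI conjI allI impI)
  show "primeideal (toric_prime (set (take k xs))) R" for k by (rule primeideal_toric_prime)
  show "toric_prime (set (take k xs)) \<subset> toric_prime (set (take (Suc k) xs))" if k: "k < length xs" for k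
  proof -
    obtain v where v: "v \<in> V" "xs ! k \<in> nodes v" "nodes v \<inter> set (take k xs) = {}"
      using assms[OF k] by blast
    show ?thesis
      by (rule toric_prime_strict[OF _ v(1,3)]) (use v(2) k in \<open>auto simp: take_Suc_conv_app_nth\<close>)
  qed
qed simp

text \<open>All rows but the base row \<open>b\<close> are killed first. The columns follow; each still has its vertex in
row \<open>b\<close> when its turn comes.\<close>

lemma shape_dim_le_krull_dim: "enat (shape_dim V) \<le> krull_dim R"
proof (cases "V = {}")
  case True
  then show ?thesis by (simp add: zero_enat_def[symmetric])
next
  case False
  then obtain i\<^sub>0 j\<^sub>0 where "(i\<^sub>0, j\<^sub>0) \<in> V" by force
  then have bottom: "(i\<^sub>0, b) \<in> V" using down base by blast
  define rows where "rows = sorted_list_of_set (snd ` V - {b})"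
  define columns where "columns = sorted_list_of_set (fst ` V)"
  have rows: "set rows = snd ` V - {b}" "distinct rows" "length rows = card (snd ` V) - 1"
  proof -
    have "b \<in> snd ` V" using bottom by force
    then show "length rows = card (snd ` V) - 1" using fin by (simp add: rows_def)
  qed (use fin in \<open>simp_all add: rows_def\<close>)
  have columns: "set columns = fst ` V" "distinct columns" "length columns = card (fst ` V)"
    using fin by (simp_all add: columns_def)
  define xs where "xs = map (\<lambda>j. 2 * j + 1) rows @ map (\<lambda>i. 2 * i) columns"
  have "card (snd ` V) > 0" using False fin by (simp add: card_gt_0_iff)
  then have len: "length xs = shape_dim V"
    by (simp add: xs_def rows(3) columns(3) shape_dim_def)
  have inj: "inj_on (\<lambda>j::nat. 2 * j + 1) A" "inj_on (\<lambda>i::nat. 2 * i) A" for A by (simp_all add: inj_on_def)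
  have dist: "distinct xs"
  proof -
    have "2 * j + 1 \<noteq> 2 * i" for i j :: nat by presburger
    then show ?thesis
      unfolding xs_def using rows(2) columns(2) inj by (auto simp: distinct_map)
  qed
  have "enat (length xs) \<le> krull_dim R"
  proof (rule krull_dim_ge_node_sequence)
    fix k assume k: "k < length xs"
    have notin: "xs ! k \<notin> set (take k xs)"
      using dist k by (metis distinct_take not_distinct_conv_prefix take_Suc_conv_app_nth)
    show "\<exists>v\<in>V. xs ! k \<in> nodes v \<and> nodes v \<inter> set (take k xs) = {}"
    proof (cases "k < length rows")
      case True
      then have "rows ! k \<in> snd ` V" using rows(1) nth_mem[OF True] by blast
      then obtain i where i: "(i, rows ! k) \<in> V" by force
      have xk: "xs ! k = 2 * (rows ! k) + 1" using True by (simp add: xs_def nth_append)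
      have "take k xs = map (\<lambda>j. 2 * j + 1) (take k rows)"
        using True by (simp add: xs_def take_map)
      then have "2 * i \<notin> set (take k xs)" by (auto; presburger)
      then have "nodes (i, rows ! k) \<inter> set (take k xs) = {}"
        using notin xk by (simp add: nodes_def)
      then show ?thesis using i xk by (intro bexI[of _ "(i, rows ! k)"]) (simp_all add: nodes_def)
    next
      case False
      define i where "i = columns ! (k - length rows)"
      have xk: "xs ! k = 2 * i" using False k by (simp add: xs_def nth_append i_def)
      have "k - length rows < length columns" using False k by (simp add: xs_def)
      then have "i \<in> fst ` V" unfolding i_def columns(1)[symmetric] by (rule nth_mem)
      then obtain j where "(i, j) \<in> V" by force
      then have ib: "(i, b) \<in> V" using down base by blast
      have "2 * b + 1 \<notin> set xs"
        using rows(1) by (auto simp: xs_def; presburger)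
      then have "2 * b + 1 \<notin> set (take k xs)" using set_take_subset by fast
      then have "nodes (i, b) \<inter> set (take k xs) = {}"
        using notin xk by (simp add: nodes_def)
      then show ?thesis using ib xk by (intro bexI[of _ "(i, b)"]) (simp_all add: nodes_def)
    qed
  qed
  then show ?thesis by (simp add: len)
qed

theorem krull_dim_eq: "krull_dim R = enat (shape_dim V)"
proof (rule antisym[OF _ shape_dim_le_krull_dim])
  obtain e where "has_mult \<kappa> V e" using ferrers_has_mult[OF ferrers] by blast
  then obtain Q where "chain_series \<kappa> V * (1 - fps_X) ^ shape_dim V = fps_of_poly Q"
    unfolding has_mult_def by blast
  then obtain C :: nat where C: "\<And>M. \<bar>\<Sum>k\<le>M. fps_nth (chain_series \<kappa> V) k\<bar> \<le> int C * int (M + 1) ^ shape_dim V"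
    using coefficient_sums_bounded by blast
  have growth: "(\<Sum>d\<le>M. card (chain_monomials \<kappa> V d)) \<le> C * (M + 1) ^ shape_dim V" for M
  proof -
    have "int (\<Sum>d\<le>M. card (chain_monomials \<kappa> V d)) \<le> int (C * (M + 1) ^ shape_dim V)"
      using C[of M] by (simp add: chain_series_def)
    then show ?thesis by (simp only: of_nat_le_iff)
  qed
  show "krull_dim R \<le> enat (shape_dim V)"
    unfolding krull_dim_def
  proof (rule Sup_least)
    fix x assume "x \<in> {enat n |n. \<exists>\<pp>. (\<forall>i\<le>n. primeideal (\<pp> i) R) \<and> (\<forall>i<n. \<pp> i \<subset> \<pp> (Suc i))}"
    then obtain n \<pp> where x: "x = enat n" and "\<And>i. i \<le> n \<Longrightarrow> primeideal (\<pp> i) R"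
      "\<And>i. i < n \<Longrightarrow> \<pp> i \<subset> \<pp> (Suc i)" by blast
    then have "n \<le> shape_dim V" using prime_chain_length_le[OF growth] by blast
    then show "x \<le> enat (shape_dim V)" by (simp add: x)
  qed
qed

theorem multiplicity_over_eq:
  assumes "has_mult \<kappa> V e"
  shows "multiplicity_over TYPE('k) P = e"
  unfolding multiplicity_over_def graded_multiplicity_def krull_dim_eq the_enat.simps
    hilbert_series_eq has_mult_def[symmetric]
  using assms has_mult_unique by blast

end

section \<open>Stacks of cells\<close>

lemma vertices_iff:
  "(i, l) \<in> vertices P \<longleftrightarrow> (\<exists>r s. (r, s) \<in> P \<and> (i = r \<or> i = Suc r) \<and> (l = s \<or> l = Suc s))"
  by (fastforce simp: vertices_def cell_vertices_def)

lemma finite_vertices: "finite P \<Longrightarrow> finite (vertices P)"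
  by (auto simp: vertices_def cell_vertices_def)

text \<open>A stack polyomino, possibly empty, whose base row is \<open>b\<close>. Translates and the empty collection
are included because the smaller polyominoes of the theorem can be of this kind.\<close>

definition stacked :: "nat \<Rightarrow> cell set \<Rightarrow> bool" where
  "stacked b P \<longleftrightarrow> finite P \<and> row_convex P \<and>
     (\<forall>r s. (r, s) \<in> P \<longrightarrow> b \<le> s \<and> (\<forall>s'. b \<le> s' \<longrightarrow> s' \<le> s \<longrightarrow> (r, s') \<in> P))"

lemma stackedD:
  assumes "stacked b P"
  shows "finite P" "\<And>r s. (r, s) \<in> P \<Longrightarrow> b \<le> s"
    "\<And>r s s'. (r, s) \<in> P \<Longrightarrow> b \<le> s' \<Longrightarrow> s' \<le> s \<Longrightarrow> (r, s') \<in> P"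
    "\<And>r r' r'' s. (r, s) \<in> P \<Longrightarrow> (r'', s) \<in> P \<Longrightarrow> r \<le> r' \<Longrightarrow> r' \<le> r'' \<Longrightarrow> (r', s) \<in> P"
  using assms unfolding stacked_def row_convex_def by blast+

lemma stacked_cell_below:
  assumes P: "stacked b P" and v: "(i, l) \<in> vertices P" and s: "b \<le> s" "s < l"
  obtains r where "(r, s) \<in> P" "i = r \<or> i = Suc r"
proof -
  obtain r s' where rs: "(r, s') \<in> P" "i = r \<or> i = Suc r" "l = s' \<or> l = Suc s'"
    using v unfolding vertices_iff by blast
  then have "s \<le> s'" using s by auto
  then show ?thesis using stackedD(3)[OF P rs(1) s(1)] rs(2) that by blast
qed

text \<open>Row \<open>s\<close> has a cell at column \<open>i\<close> and one at column \<open>k\<close>, and by row convexity everything between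
them.\<close>

lemma stacked_inner:
  assumes P: "stacked b P" and v: "(i, l) \<in> vertices P" "(k, l) \<in> vertices P" "i < k"
    and rs: "b \<le> s" "s < l" "i \<le> r" "r < k"
  shows "(r, s) \<in> P"
proof -
  obtain p where p: "(p, s) \<in> P" "i = p \<or> i = Suc p"
    using stacked_cell_below[OF P v(1) rs(1,2)] .
  obtain q where q: "(q, s) \<in> P" "k = q \<or> k = Suc q"
    using stacked_cell_below[OF P v(2) rs(1,2)] .
  show ?thesis by (rule stackedD(4)[OF P p(1) q(1)]) (use p(2) q(2) rs in auto)
qed

lemma stacked_vertices:
  assumes "stacked b P" "(i, l) \<in> vertices P"
  shows "b \<le> l" "\<And>l'. b \<le> l' \<Longrightarrow> l' \<le> l \<Longrightarrow> (i, l') \<in> vertices P"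
proof -
  show "b \<le> l" using assms(2) stackedD(2)[OF assms(1)] unfolding vertices_iff by force
  fix l' assume l': "b \<le> l'" "l' \<le> l"
  show "(i, l') \<in> vertices P"
  proof (cases "l' = l")
    case False
    then obtain r where "(r, l') \<in> P" "i = r \<or> i = Suc r"
      using stacked_cell_below[OF assms, of l'] l' by auto
    then show ?thesis unfolding vertices_iff by blast
  qed (use assms(2) in simp)
qed

lemma ferrers_polyomino_stacked:
  assumes "stacked b P" "ferrers \<kappa> b (vertices P)"
  shows "ferrers_polyomino \<kappa> b P"
proof
  show "(r, s) \<in> P" if "(i, l) \<in> vertices P" "(k, l) \<in> vertices P" "i < k" "b \<le> j" "j < l"
    "i \<le> r" "r < k" "j \<le> s" "s < l" for i k l j r s
    using stacked_inner[OF assms(1) that(1-3), of s r] that by simp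
qed (rule assms(2))

lemma ferrers_restrict_columns:
  assumes "ferrers \<kappa> b V"
  shows "ferrers \<kappa> b {v \<in> V. Q (fst v)}"
proof (rule ferrersI)
  note f = ferrersD[OF assms]
  show "inj_on \<kappa> (fst ` {v \<in> V. Q (fst v)})"
    by (rule inj_on_subset[OF f(2)]) auto
  show "(k, j) \<in> {v \<in> V. Q (fst v)}"
    if "(i, j) \<in> {v \<in> V. Q (fst v)}" "(k, l) \<in> {v \<in> V. Q (fst v)}" "\<kappa> i < \<kappa> k" for i j k l
  proof -
    have "k \<in> fst ` V" using imageI[of "(k, l)" V fst] that(2) by simp
    then show ?thesis using f(5)[of i j k] that by simp
  qed
  show "(i, j') \<in> {v \<in> V. Q (fst v)}"
    if "(i, j) \<in> {v \<in> V. Q (fst v)}" "b \<le> j'" "j' \<le> j" for i j j'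
    using f(4)[of i j j'] that by simp
qed (use ferrersD(1,3)[OF assms] in auto)

lemma ferrers_restrict_rows:
  assumes "ferrers \<kappa> b V"
  shows "ferrers \<kappa> b {v \<in> V. snd v \<le> L}"
proof (rule ferrersI)
  note f = ferrersD[OF assms]
  show "inj_on \<kappa> (fst ` {v \<in> V. snd v \<le> L})"
    by (rule inj_on_subset[OF f(2)]) auto
  show "(k, j) \<in> {v \<in> V. snd v \<le> L}"
    if "(i, j) \<in> {v \<in> V. snd v \<le> L}" "(k, l) \<in> {v \<in> V. snd v \<le> L}" "\<kappa> i < \<kappa> k" for i j k l
  proof -
    have "k \<in> fst ` V" using imageI[of "(k, l)" V fst] that(2) by simp
    then show ?thesis using f(5)[of i j k] that by simp
  qed
  show "(i, j') \<in> {v \<in> V. snd v \<le> L}"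
    if "(i, j) \<in> {v \<in> V. snd v \<le> L}" "b \<le> j'" "j' \<le> j" for i j j'
    using f(4)[of i j j'] that by simp
qed (use ferrersD(1,3)[OF assms] in auto)

text \<open>The first column in the order \<open>\<kappa>\<close> is the leftmost or the rightmost one, and it is a shortest
column. The two situations of the theorem are the two values of \<open>c\<close>.\<close>

locale stack_corner = ferrers_corner \<kappa> 1 "vertices P" c j
  for \<kappa> :: "nat \<Rightarrow> nat" and P :: "cell set" and m c j :: nat +
  assumes stacked: "stacked 1 P"
    and columns: "\<And>r s. (r, s) \<in> P \<Longrightarrow> 1 \<le> r \<and> r < m"
    and bottom_row: "\<And>r. 1 \<le> r \<Longrightarrow> r < m \<Longrightarrow> (r, 1) \<in> P"
    and m: "2 \<le> m"
    and c: "c = 1 \<or> c = m"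
begin

abbreviation "V \<equiv> vertices P"

definition corner_cell :: cell where
  "corner_cell = (if c = 1 then 1 else m - 1, j - 1)"

definition cells_above :: "cell set" where
  "cells_above = {C \<in> P. j \<le> snd C}"

lemma vertex_columns: "(k, l) \<in> V \<Longrightarrow> 1 \<le> k \<and> k \<le> m"
  unfolding vertices_iff using columns by fastforce

lemma bottom_vertices:
  assumes "1 \<le> k" "k \<le> m" "l = 1 \<or> l = 2"
  shows "(k, l) \<in> V"
proof (cases "k = m")
  case True
  then have "(m - 1, 1) \<in> P" "k = Suc (m - 1)" using bottom_row[of "m - 1"] m by auto
  then show ?thesis unfolding vertices_iff using assms(3) by (intro exI[of _ "m - 1"] exI[of _ 1]) auto
next
  case False
  then have "(k, 1) \<in> P" using bottom_row assms by simp
  then show ?thesis unfolding vertices_iff using assms(3) by (intro exI[of _ k] exI[of _ 1]) auto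
qed

lemma fst_V: "fst ` V = {1..m}"
proof
  show "{1..m} \<subseteq> fst ` V"
  proof
    fix k assume "k \<in> {1..m}"
    then have "(k, 1) \<in> V" using bottom_vertices by simp
    then show "k \<in> fst ` V" by force
  qed
qed (use vertex_columns in fastforce)

lemma j_ge_2: "2 \<le> j"
  using bottom_vertices[of c 2] c m corner_column[of 2] by auto

text \<open>Both outermost columns reach row \<open>j\<close>, so the part of the stack below that row is a full
rectangle.\<close>

lemma rows_below_full: "1 \<le> r \<Longrightarrow> r < m \<Longrightarrow> 1 \<le> s \<Longrightarrow> s < j \<Longrightarrow> (r, s) \<in> P"
  using stacked_inner[OF stacked, of 1 j m s r] rectangle[of 1 j] rectangle[of m j] fst_V m base_le_corner by auto

lemma corner_cell_in: "corner_cell \<in> P"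
  unfolding corner_cell_def using rows_below_full[of "if c = 1 then 1 else m - 1" "j - 1"] m j_ge_2 by auto

lemma cells_at_corner: "C \<in> P \<Longrightarrow> (c, j) \<in> cell_vertices C \<longleftrightarrow> C = corner_cell"
proof -
  assume C: "C \<in> P"
  obtain r s where rs: "C = (r, s)" by force
  have r: "1 \<le> r" "r < m" using columns C rs by blast+
  show ?thesis
  proof
    assume "(c, j) \<in> cell_vertices C"
    then have cj: "c = r \<or> c = Suc r" "j = s \<or> j = Suc s" unfolding rs cell_vertices_def by auto
    have "j \<noteq> s"
    proof
      assume "j = s"
      then have "(c, Suc j) \<in> V" unfolding vertices_iff using C rs cj(1) by blast
      then show False using corner(2) by simp
    qed
    then have "s = j - 1" using cj(2) by simp
    moreover have "r = (if c = 1 then 1 else m - 1)" using cj(1) c r m by auto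
    ultimately show "C = corner_cell" by (simp add: rs corner_cell_def)
  next
    assume "C = corner_cell"
    then show "(c, j) \<in> cell_vertices C"
      using c m j_ge_2 by (auto simp: corner_cell_def cell_vertices_def)
  qed
qed

lemma delete_cells_at_corner: "delete_cells_at (c, j) P = P - {corner_cell}"
  unfolding delete_cells_at_def using cells_at_corner corner_cell_in by blast

lemma stacked_remove_corner_cell: "stacked 1 (P - {corner_cell})"
  unfolding stacked_def
proof (intro conjI allI impI)
  note s = stackedD[OF stacked]
  show "finite (P - {corner_cell})" using s(1) by simp
  show "row_convex (P - {corner_cell})"
    unfolding row_convex_def
  proof (intro allI impI)
    fix p q r t assume pq: "(p, t) \<in> P - {corner_cell}" "(q, t) \<in> P - {corner_cell}" "p \<le> r" "r \<le> q"
    have "(r, t) \<in> P" using s(4)[of p t q r] pq by simp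
    moreover have "(r, t) \<noteq> corner_cell"
      using pq columns[of p t] columns[of q t] by (auto simp: corner_cell_def split: if_splits)
    ultimately show "(r, t) \<in> P - {corner_cell}" by simp
  qed
  fix r t assume rt: "(r, t) \<in> P - {corner_cell}"
  show "1 \<le> t" using s(2)[of r t] rt by simp
  fix t' assume t': "1 \<le> t'" "t' \<le> t"
  have "(r, t') \<in> P" using s(3)[of r t t'] rt t' by simp
  moreover have "(r, t') \<noteq> corner_cell"
  proof
    assume cell: "(r, t') = corner_cell"
    then have "t' < t" using rt t' by (cases "t' = t") auto
    then have "j \<le> t" using cell by (simp add: corner_cell_def)
    then have "(r, j) \<in> P" using s(3)[of r t j] rt base_le_corner by simp
    then have "(c, Suc j) \<in> V"
      unfolding vertices_iff using cell c m
      by (intro exI[of _ r] exI[of _ j]) (auto simp: corner_cell_def split: if_splits)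
    then show False using corner(2) by simp
  qed
  ultimately show "(r, t') \<in> P - {corner_cell}" by simp
qed

lemma stacked_cells_above: "stacked j cells_above"
  unfolding stacked_def
proof (intro conjI allI impI)
  note s = stackedD[OF stacked]
  show "finite cells_above" using s(1) by (simp add: cells_above_def)
  show "row_convex cells_above"
    unfolding row_convex_def
  proof (intro allI impI)
    fix p q r t assume pq: "(p, t) \<in> cells_above" "(q, t) \<in> cells_above" "p \<le> r" "r \<le> q"
    then show "(r, t) \<in> cells_above" using s(4)[of p t q r] by (simp add: cells_above_def)
  qed
  fix r t assume rt: "(r, t) \<in> cells_above"
  then show "j \<le> t" by (simp add: cells_above_def)
  fix t' assume "j \<le> t'" "t' \<le> t"
  then show "(r, t') \<in> cells_above"
    using s(3)[of r t t'] rt base_le_corner by (simp add: cells_above_def)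
qed

text \<open>The columns that end in row \<open>j\<close> contribute a vertex to the upper right part but none to the cells
above that row.\<close>

lemma vertices_cells_above: "vertices cells_above = {v \<in> upper_right. (fst v, Suc j) \<in> upper_right}"
proof (rule Set.set_eqI)
  fix v :: vertex
  obtain k l where v: "v = (k, l)" by force
  show "v \<in> vertices cells_above \<longleftrightarrow> v \<in> {v \<in> upper_right. (fst v, Suc j) \<in> upper_right}"
  proof
    assume "v \<in> vertices cells_above"
    then obtain r s where rs: "(r, s) \<in> P" "j \<le> s" "k = r \<or> k = Suc r" "l = s \<or> l = Suc s"
      unfolding v vertices_iff cells_above_def by auto
    have "(r, j) \<in> P" using stackedD(3)[OF stacked rs(1) base_le_corner rs(2)] .
    then have kj: "(k, Suc j) \<in> V" unfolding vertices_iff using rs(3) by blast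
    then have "k \<noteq> c" using corner(2) by auto
    moreover have "(k, l) \<in> V" unfolding vertices_iff using rs by blast
    ultimately show "v \<in> {v \<in> upper_right. (fst v, Suc j) \<in> upper_right}"
      using kj rs(2,4) by (auto simp: v upper_right_def)
  next
    assume "v \<in> {v \<in> upper_right. (fst v, Suc j) \<in> upper_right}"
    then have kl: "(k, l) \<in> V" "j \<le> l" "(k, Suc j) \<in> V" by (auto simp: v upper_right_def)
    show "v \<in> vertices cells_above"
    proof (cases "l = j")
      case True
      obtain r where "(r, j) \<in> P" "k = r \<or> k = Suc r"
        using stacked_cell_below[OF stacked kl(3) base_le_corner] by auto
      then show ?thesis unfolding v vertices_iff cells_above_def True by auto
    next
      case False
      then have "1 \<le> l - 1" "l - 1 < l" "l = Suc (l - 1)" "j \<le> l - 1" using kl(2) base_le_corner by auto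
      moreover from this obtain r where "(r, l - 1) \<in> P" "k = r \<or> k = Suc r"
        using stacked_cell_below[OF stacked kl(1)] by blast
      ultimately show ?thesis unfolding v vertices_iff cells_above_def
        by (intro exI[of _ r] exI[of _ "l - 1"]) auto
    qed
  qed
qed

lemma corner_notin: "(c, j) \<notin> vertices (P - {corner_cell})"
proof
  assume "(c, j) \<in> vertices (P - {corner_cell})"
  then obtain C where "C \<in> P - {corner_cell}" "(c, j) \<in> cell_vertices C" unfolding vertices_def by blast
  then show False using cells_at_corner by blast
qed

lemma vertices_remove_corner_subset: "vertices (P - {corner_cell}) \<subseteq> V - {(c, j)}"
  using corner_notin unfolding vertices_def by blast

text \<open>Besides its corner vertex, the deleted cell loses a vertex only if it is the whole column of cells:
its other vertices belong to the cell below it or to the neighbouring cell in its row.\<close>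

lemma vertices_remove_corner_wide:
  assumes "3 \<le> m"
  shows "vertices (P - {corner_cell}) = (if j = 2 then {v \<in> V. fst v \<noteq> c} else V - {(c, j)})"
    (is "?V1 = ?W")
proof (intro equalityI subsetI)
  fix v assume v: "v \<in> ?V1"
  then have "v \<in> V - {(c, j)}" using vertices_remove_corner_subset by blast
  moreover have "fst v \<noteq> c" if "j = 2"
  proof
    assume "fst v = c"
    then have "(c, snd v) \<in> ?V1" using v by (metis prod.collapse)
    then obtain r s where rs: "(r, s) \<in> P" "(r, s) \<noteq> corner_cell" "c = r \<or> c = Suc r" "snd v = s \<or> snd v = Suc s"
      unfolding vertices_iff by blast
    have "r = (if c = 1 then 1 else m - 1)" using columns[OF rs(1)] rs(3) c m by auto
    then have "corner_cell = (r, j - 1)" by (simp only: corner_cell_def)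
    then have "s \<noteq> 1" using rs(2) \<open>j = 2\<close> by auto
    then have "2 \<le> s" using stackedD(2)[OF stacked rs(1)] by simp
    then have "(c, Suc s) \<in> V" unfolding vertices_iff using rs(1,3) by blast
    then show False using corner_column[of "Suc s"] that \<open>2 \<le> s\<close> by simp
  qed
  ultimately show "v \<in> ?W" by simp
next
  fix v assume v: "v \<in> ?W"
  obtain k l where kl: "v = (k, l)" by force
  have V: "(k, l) \<in> V" "(k, l) \<noteq> (c, j)" using v corner(1) by (auto simp: kl split: if_splits)
  then obtain r s where rs: "(r, s) \<in> P" "k = r \<or> k = Suc r" "l = s \<or> l = Suc s"
    unfolding vertices_iff by blast
  show "v \<in> ?V1"
  proof (cases "(r, s) = corner_cell")
    case False
    then show ?thesis unfolding kl vertices_iff using rs by blast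
  next
    case True
    define r' where "r' = (if c = 1 then 2 else m - 2)"
    show ?thesis
    proof (cases "k = c")
      case True
      then have j: "j \<noteq> 2" using v kl by auto
      have "l = j - 1" using True V(2) rs(3) \<open>(r, s) = corner_cell\<close> j_ge_2 by (auto simp: corner_cell_def)
      then have "(r, j - 2) \<in> P - {corner_cell}" "l = Suc (j - 2)"
        using rows_below_full[of r "j - 2"] columns[OF rs(1)] j j_ge_2 by (auto simp: corner_cell_def)
      then show ?thesis unfolding kl vertices_iff using rs(2) by blast
    next
      case False
      have "(r', j - 1) \<in> P - {corner_cell}"
        using rows_below_full[of r' "j - 1"] assms j_ge_2 by (auto simp: r'_def corner_cell_def)
      moreover have "k = r' \<or> k = Suc r'"
        using rs(2) True False c assms by (auto simp: r'_def corner_cell_def split: if_splits)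
      moreover have "l = j - 1 \<or> l = Suc (j - 1)" using rs(3) True by (auto simp: corner_cell_def)
      ultimately show ?thesis unfolding kl vertices_iff by blast
    qed
  qed
qed

text \<open>With a single column of cells the deleted cell has no neighbour in its row, so that the whole top row of
vertices disappears.\<close>

lemma one_column_stack:
  assumes "m = 2"
  shows "c = 1 \<or> c = 2" "V = {1, 2} \<times> {1..j}"
    "vertices (P - {corner_cell}) = (if j = 2 then {} else {1, 2} \<times> {1..j - 1})"
proof -
  show "c = 1 \<or> c = 2" using c assms by simp
  have P: "(r, s) \<in> P \<longleftrightarrow> r = 1 \<and> 1 \<le> s \<and> s < j" for r s
  proof
    assume rs: "(r, s) \<in> P"
    then have r: "r = 1" "1 \<le> s" using columns[OF rs] stackedD(2)[OF stacked rs] assms by auto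
    have "(c, Suc s) \<in> V" unfolding vertices_iff using rs r(1) c assms by (intro exI[of _ r] exI[of _ s]) auto
    then show "r = 1 \<and> 1 \<le> s \<and> s < j" using r corner_column by simp
  qed (use rows_below_full assms in auto)
  have corner_cell: "corner_cell = (1, j - 1)" unfolding corner_cell_def using c assms by auto
  have rectangle_vertices: "(i, l) \<in> vertices {C \<in> P. snd C < h} \<longleftrightarrow> (i = 1 \<or> i = 2) \<and> 1 \<le> l \<and> l \<le> h"
    if h: "2 \<le> h" "h \<le> j" for h i l
  proof
    assume "(i, l) \<in> vertices {C \<in> P. snd C < h}"
    then show "(i = 1 \<or> i = 2) \<and> 1 \<le> l \<and> l \<le> h" unfolding vertices_iff using P by auto
  next
    assume il: "(i = 1 \<or> i = 2) \<and> 1 \<le> l \<and> l \<le> h"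
    define s where "s = (if l = 1 then 1 else l - 1)"
    have "(1, s) \<in> {C \<in> P. snd C < h}" "l = s \<or> l = Suc s" using il h P by (auto simp: s_def)
    moreover have "i = 1 \<or> i = Suc 1" using il by auto
    ultimately show "(i, l) \<in> vertices {C \<in> P. snd C < h}" unfolding vertices_iff by blast
  qed
  have "{C \<in> P. snd C < j} = P" using P by auto
  then show "V = {1, 2} \<times> {1..j}" using rectangle_vertices[of j] j_ge_2 by auto
  have P1: "{C \<in> P. snd C < j - 1} = P - {corner_cell}" using P by (auto simp: corner_cell)
  show "vertices (P - {corner_cell}) = (if j = 2 then {} else {1, 2} \<times> {1..j - 1})"
  proof (cases "j = 2")
    case True
    have "P \<subseteq> {(1, 1)}"
    proof
      fix C assume "C \<in> P"
      then show "C \<in> {(1, 1)}" using P[of "fst C" "snd C"] True by (cases C) simp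
    qed
    moreover have "corner_cell = (1, 1)" unfolding corner_cell using True by simp
    ultimately have empty: "P - {corner_cell} = {}" by simp
    have "vertices (P - {corner_cell}) = {}" unfolding empty vertices_def by simp
    then show ?thesis by (simp only: True if_P)
  next
    case False
    then show ?thesis using rectangle_vertices[of "j - 1"] j_ge_2 unfolding P1 by auto
  qed
qed

lemma ferrers_vertices_remove_corner: "ferrers \<kappa> 1 (vertices (P - {corner_cell}))"
proof (cases "3 \<le> m")
  case True
  then show ?thesis
    using ferrers_restrict_columns[OF ferrers, of "\<lambda>k. k \<noteq> c"] ferrers_remove_corner
    by (simp add: vertices_remove_corner_wide)
next
  case False
  then have m2: "m = 2" using m by simp
  \<comment> \<open>For \<open>j = 2\<close> nothing is left; the bound \<open>0\<close> selects the empty set because rows start at \<open>1\<close>.\<close>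
  have "{v \<in> V. snd v \<le> (if j = 2 then 0 else j - 1)} = vertices (P - {corner_cell})"
    using one_column_stack(2,3)[OF m2] j_ge_2 by auto
  then show ?thesis using ferrers_restrict_rows[OF ferrers] by metis
qed

text \<open>Deleting the corner cell may remove more than the corner vertex from the shape. What else
disappears are free variables of the shape without its corner: the bottom vertex of column
\<open>c\<close>, the rest of the top row, or everything when \<open>P\<close> is a single cell.\<close>

lemma has_mult_remove_corner:
  assumes e: "has_mult \<kappa> (vertices (P - {corner_cell})) e"
  shows "has_mult \<kappa> (V - {(c, j)}) e"
proof -
  consider "3 \<le> m" "j = 2" | "3 \<le> m" "j \<noteq> 2" | "m = 2" "j = 2" | "m = 2" "j \<noteq> 2"
    using m by linarith
  then show ?thesis
  proof cases
    case 1
    show ?thesis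
    proof (rule has_mult_remove_low_columns[OF ferrers_remove_corner])
      have "{v \<in> V - {(c, j)}. (fst v, Suc 1) \<in> V - {(c, j)}} = {v \<in> V. fst v \<noteq> c}"
      proof (rule Set.set_eqI)
        fix v :: vertex
        obtain k l where v: "v = (k, l)" by force
        have "(k, Suc 1) \<in> V - {(c, j)} \<longleftrightarrow> k \<noteq> c" if "(k, l) \<in> V"
          using bottom_vertices[of k 2] vertex_columns[OF that] 1(2) by (auto simp: numeral_2_eq_2)
        moreover have "k \<noteq> c \<Longrightarrow> (k, l) \<noteq> (c, j)" by simp
        ultimately show "v \<in> {v \<in> V - {(c, j)}. (fst v, Suc 1) \<in> V - {(c, j)}} \<longleftrightarrow> v \<in> {v \<in> V. fst v \<noteq> c}"
          unfolding v mem_Collect_eq fst_conv by blast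
      qed
      then show "has_mult \<kappa> {v \<in> V - {(c, j)}. (fst v, Suc 1) \<in> V - {(c, j)}} e"
        using e vertices_remove_corner_wide[OF 1(1)] 1(2) by simp
    qed
  next
    case 2
    then show ?thesis using e vertices_remove_corner_wide by simp
  next
    case 3
    define d where "d = (if c = 1 then 2 else 1 :: nat)"
    have cd: "{1, 2} = {c, d}" "c \<noteq> d" using one_column_stack(1)[OF 3(1)] by (auto simp: d_def)
    have V: "V - {(c, j)} = {(c, 1), (d, 1), (d, 2)}"
      unfolding one_column_stack(2)[OF 3(1)] cd(1) using 3(2) cd(2) by auto
    have less: "\<kappa> c < \<kappa> d" using first_less[of d] fst_V cd 3(1) by (auto simp: d_def)
    show ?thesis
    proof (rule has_mult_remove_free_set[of _ _ "V - {(c, j)}"])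
      show "has_mult \<kappa> (V - {(c, j)} - (V - {(c, j)})) e"
        using e one_column_stack(3)[OF 3(1)] 3(2) by simp
      show "comparable \<kappa> v w" if "v \<in> V - {(c, j)}" "w \<in> V - {(c, j)}" for v w
        using that less unfolding V by (auto simp: comparable_def)
      show "shape_dim (V - {(c, j)}) = card (V - {(c, j)}) + shape_dim (V - {(c, j)} - (V - {(c, j)}))"
        unfolding V using cd(2) by (simp add: shape_dim_def)
    qed (use fin in auto)
  next
    case 4
    define d where "d = (if c = 1 then 2 else 1 :: nat)"
    have cd: "{1, 2} = {c, d}" "c \<noteq> d" using one_column_stack(1)[OF 4(1)] by (auto simp: d_def)
    have j3: "3 \<le> j" using j_ge_2 4(2) by simp
    have less: "\<kappa> c < \<kappa> d" using first_less[of d] fst_V cd 4(1) by (auto simp: d_def)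
    have V: "V = {c, d} \<times> {1..j}" using one_column_stack(2)[OF 4(1)] cd(1) by simp
    have V1: "V - {(c, j)} - {(d, j)} = {c, d} \<times> {1..j - 1}" unfolding V using cd(2) j3 by auto
    show ?thesis
    proof (rule has_mult_remove_free[of _ _ "(d, j)"])
      show "has_mult \<kappa> (V - {(c, j)} - {(d, j)}) e"
        using e one_column_stack(3)[OF 4(1)] 4(2) cd(1) V1 by simp
      show "(d, j) \<in> V - {(c, j)}" using cd(2) j3 by (simp add: V)
      show "comparable \<kappa> (d, j) w" if "w \<in> V - {(c, j)}" for w
        using that less by (auto simp: V comparable_def)
      have "fst ` (V - {(c, j)}) = {c, d}" "snd ` (V - {(c, j)}) = {1..j}"
      proof -
        have "(c, 1) \<in> V - {(c, j)}" "(d, l) \<in> V - {(c, j)}" if "l \<in> {1..j}" for l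
          using cd(2) j3 that by (auto simp: V)
        then show "fst ` (V - {(c, j)}) = {c, d}" "snd ` (V - {(c, j)}) = {1..j}"
          using j3 unfolding V by force+
      qed
      moreover have "fst ` ({c, d} \<times> {1..j - 1}) = {c, d}" "snd ` ({c, d} \<times> {1..j - 1}) = {1..j - 1}"
        using j3 by force+
      ultimately show "shape_dim (V - {(c, j)}) = Suc (shape_dim (V - {(c, j)} - {(d, j)}))"
        unfolding V1 shape_dim_def using cd(2) j3 by simp
    qed (use fin in auto)
  qed
qed

theorem multiplicity_recursion:
  "multiplicity_over TYPE('k::field) P =
     multiplicity_over TYPE('k) (P - {corner_cell}) + multiplicity_over TYPE('k) cells_above"
proof -
  let ?P1 = "P - {corner_cell}"
  have ferrers2: "ferrers \<kappa> j (vertices cells_above)"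
    unfolding vertices_cells_above
    using ferrers_restrict_columns[OF ferrers_upper_right, of "\<lambda>k. (k, Suc j) \<in> upper_right"] .
  obtain e\<^sub>1 where e1: "has_mult \<kappa> (vertices ?P1) e\<^sub>1"
    using ferrers_has_mult[OF ferrers_vertices_remove_corner] by blast
  obtain e\<^sub>2 where e2: "has_mult \<kappa> (vertices cells_above) e\<^sub>2"
    using ferrers_has_mult[OF ferrers2] by blast
  have "has_mult \<kappa> upper_right e\<^sub>2"
    using has_mult_remove_low_columns[OF ferrers_upper_right] e2 unfolding vertices_cells_above .
  moreover have "fst ` V \<noteq> {c}"
  proof
    assume "fst ` V = {c}"
    then have "card {1..m} = 1" unfolding fst_V by simp
    then show False using m by simp
  qed
  ultimately have "has_mult \<kappa> V (e\<^sub>1 + e\<^sub>2)"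
    using has_mult_corner[OF _ _ has_mult_remove_corner[OF e1]] j_ge_2 by simp
  then have "multiplicity_over TYPE('k) P = e\<^sub>1 + e\<^sub>2"
    by (rule ferrers_polyomino.multiplicity_over_eq[OF ferrers_polyomino_stacked[OF stacked ferrers]])
  moreover have "multiplicity_over TYPE('k) ?P1 = e\<^sub>1"
    by (rule ferrers_polyomino.multiplicity_over_eq[OF ferrers_polyomino_stacked
        [OF stacked_remove_corner_cell ferrers_vertices_remove_corner] e1])
  moreover have "multiplicity_over TYPE('k) cells_above = e\<^sub>2"
    by (rule ferrers_polyomino.multiplicity_over_eq[OF ferrers_polyomino_stacked
        [OF stacked_cells_above ferrers2] e2])
  ultimately show ?thesis by simp
qed

end

lemma stack_polyomino_stacked:
  assumes "stack_polyomino m n P"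
  shows "stacked 1 P" "\<And>r s. (r, s) \<in> P \<Longrightarrow> 1 \<le> r \<and> r < m" "\<And>r. 1 \<le> r \<Longrightarrow> r < m \<Longrightarrow> (r, 1) \<in> P" "2 \<le> m"
proof -
  have P: "P \<noteq> {}" "finite P" "row_convex P" "column_convex P" "vertices P \<subseteq> {1..m} \<times> {1..n}"
    and bottom: "\<forall>i\<in>{1..m-1}. (i, 1) \<in> P"
    using assms by (auto simp: stack_polyomino_def convex_polyomino_def polyomino_def on_grid_def)
  have cells: "1 \<le> r \<and> r < m \<and> 1 \<le> s" if "(r, s) \<in> P" for r s
  proof -
    have "(r, s) \<in> vertices P" "(Suc r, s) \<in> vertices P" unfolding vertices_iff using that by blast+
    then show ?thesis using P(5) by auto
  qed
  then show "1 \<le> r \<and> r < m" if "(r, s) \<in> P" for r s using that by blast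
  show bottom': "(r, 1) \<in> P" if "1 \<le> r" "r < m" for r using bottom that by simp
  obtain r s where "(r, s) \<in> P" using P(1) by force
  then show "2 \<le> m" using cells[of r s] by linarith
  show "stacked 1 P"
    unfolding stacked_def
  proof (intro conjI allI impI)
    fix r s s' assume rs: "(r, s) \<in> P" and s': "1 \<le> s'" "s' \<le> s"
    then have "(r, 1) \<in> P" using cells bottom' by blast
    then show "(r, s') \<in> P" using P(4) rs s' unfolding column_convex_def by blast
  qed (use P cells in auto)
qed

lemma height_vertices:
  assumes "stacked 1 P" "(k, 1) \<in> vertices P"
  shows "(k, l) \<in> vertices P \<longleftrightarrow> 1 \<le> l \<and> l \<le> height P k"
proof -
  let ?C = "{l. (k, l) \<in> vertices P}"
  have "?C \<subseteq> snd ` vertices P" by force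
  then have fin: "finite ?C"
    using finite_subset finite_imageI[OF finite_vertices[OF stackedD(1)[OF assms(1)]]] by blast
  then have "height P k \<in> ?C" unfolding height_def by (rule Max_in) (use assms(2) in auto)
  then have top: "(k, height P k) \<in> vertices P" by simp
  show ?thesis
  proof
    assume kl: "(k, l) \<in> vertices P"
    then have "l \<le> height P k" unfolding height_def by (intro Max_ge[OF fin]) simp
    then show "1 \<le> l \<and> l \<le> height P k" using stacked_vertices(1)[OF assms(1) kl] by simp
  next
    assume "1 \<le> l \<and> l \<le> height P k"
    then show "(k, l) \<in> vertices P" using stacked_vertices(2)[OF assms(1) top] by simp
  qed
qed

text \<open>If the smallest variable lies in the first column, this column is in front. Otherwise it lies in a
shortest column, and convexity forces the last column to be equally short: were it higher, then
it and the first column would both exceed the height \<open>j\<close>, and so would all columns between them.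
Then the last column is in front.\<close>

theorem theorem5p6:
  fixes P P\<^sub>1 P\<^sub>2 :: "cell set" and m n i j :: nat
  assumes "stack_polyomino m n P"
    and "(i, j) \<in> vertices P"
    and "smallest_variable P (i, 1)"
    and "j = height P i"
    and "P\<^sub>1 = (if i = 1 then delete_cells_at (i, j) P
               else delete_cells_at (m, height P m) P)"
    and "P\<^sub>2 = delete_cells_below j P"
  shows "multiplicity_over TYPE('k::field) P =
         multiplicity_over TYPE('k) P\<^sub>1 + multiplicity_over TYPE('k) P\<^sub>2"
proof -
  note stack = stack_polyomino_stacked[OF assms(1)]
  let ?V = "vertices P"
  let ?h = "height P"
  have V_columns: "1 \<le> k \<and> k \<le> m" if "(k, l) \<in> ?V" for k l
    using that stack(2) unfolding vertices_iff by fastforce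
  have bottom: "(k, 1) \<in> ?V" if "1 \<le> k" "k \<le> m" for k
  proof (cases "k = m")
    case True
    then have "(m - 1, 1) \<in> P" "k = Suc (m - 1)" using stack(3)[of "m - 1"] stack(4) by auto
    then show ?thesis unfolding vertices_iff by blast
  next
    case False
    then have "(k, 1) \<in> P" using stack(3) that by simp
    then show ?thesis unfolding vertices_iff by blast
  qed
  have V: "(k, l) \<in> ?V \<longleftrightarrow> 1 \<le> k \<and> k \<le> m \<and> 1 \<le> l \<and> l \<le> ?h k" for k l
    using V_columns[of k l] height_vertices[OF stack(1) bottom] by blast
  have i: "1 \<le> i" "i \<le> m" using V_columns[OF assms(2)] by auto
  have smallest: "?h k > j \<or> (?h k = j \<and> k > i)" if "1 \<le> k" "k \<le> m" "k \<noteq> i" for k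
  proof -
    have "var_greater P (k, 1) (i, 1)"
      using assms(3) bottom[OF that(1,2)] that(3) unfolding smallest_variable_def by blast
    then show ?thesis using that(3) assms(4) by (auto simp: var_greater_def)
  qed
  have minimal: "j \<le> ?h k" if "1 \<le> k" "k \<le> m" for k
    using smallest[OF that] assms(4) by (cases "k = i") auto
  define c where "c = (if i = 1 then 1 else m)"
  have c: "1 \<le> c" "c \<le> m" using stack(4) by (auto simp: c_def)
  have hc: "?h c = j"
  proof (cases "i = 1 \<or> i = m")
    case True
    then show ?thesis using assms(4) by (auto simp: c_def)
  next
    case False
    then have im: "1 < i" "i < m" using i by auto
    have "\<not> j < ?h m"
    proof
      assume "j < ?h m"
      moreover have "j < ?h 1" using smallest[of 1] im by auto
      ultimately have "(1, Suc j) \<in> ?V" "(m, Suc j) \<in> ?V" using V im by auto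
      moreover have "1 \<le> j" using assms(2) V by blast
      ultimately have "(i, j) \<in> P"
        using stacked_inner[OF stack(1), of 1 "Suc j" m j i] im by auto
      then have "(i, Suc j) \<in> ?V" unfolding vertices_iff by blast
      then show False using V assms(4) by simp
    qed
    then show ?thesis using minimal[of m] im by (simp add: c_def)
  qed
  \<comment> \<open>Lexicographic by height and index, except that \<open>c\<close> comes first.\<close>
  define \<kappa> where "\<kappa> k = (if k = c then 0 else ?h k * (m + 1) + k)" for k
  have \<kappa>_le: "?h k \<le> ?h k'" if "\<kappa> k < \<kappa> k'" "1 \<le> k" "k \<le> m" "1 \<le> k'" "k' \<le> m" for k k'
  proof (cases "k = c")
    case True
    then show ?thesis using hc minimal that by simp
  next
    case False
    show ?thesis
    proof (rule ccontr)
      assume "\<not> ?h k \<le> ?h k'"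
      then have "Suc (?h k') * (m + 1) \<le> ?h k * (m + 1)" by (intro mult_le_mono1) simp
      then have "?h k' * (m + 1) + k' < ?h k * (m + 1) + k" using that(5) by simp
      then show False using that(1) False by (simp add: \<kappa>_def split: if_splits)
    qed
  qed
  have \<kappa>_inj: "inj_on \<kappa> {1..m}"
  proof (rule inj_onI)
    fix k k' assume k: "k \<in> {1..m}" "k' \<in> {1..m}" "\<kappa> k = \<kappa> k'"
    have mod: "(x * (m + 1) + y) mod (m + 1) = y" if "y \<le> m" for x y :: nat
    proof -
      have "(x * (m + 1) + y) mod (m + 1) = y mod (m + 1)" by (rule mod_mult_self3)
      also have "\<dots> = y" using that by (intro mod_less) simp
      finally show ?thesis .
    qed
    show "k = k'"
    proof (cases "k = c \<or> k' = c")
      case True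
      then show ?thesis using k by (auto simp: \<kappa>_def split: if_splits)
    next
      case False
      then have eq: "?h k * (m + 1) + k = ?h k' * (m + 1) + k'" using k(3) by (simp add: \<kappa>_def)
      have "k = (?h k * (m + 1) + k) mod (m + 1)" by (rule mod [symmetric]) (use k(1) in simp)
      also have "\<dots> = (?h k' * (m + 1) + k') mod (m + 1)" by (simp only: eq)
      also have "\<dots> = k'" by (rule mod) (use k(2) in simp)
      finally show ?thesis .
    qed
  qed
  have fst_V: "fst ` ?V \<subseteq> {1..m}" using V_columns by force
  interpret stack_corner \<kappa> P m c j
  proof
    show "ferrers \<kappa> 1 ?V"
    proof (rule ferrersI)
      show "finite ?V" by (rule finite_vertices[OF stackedD(1)[OF stack(1)]])
      show "inj_on \<kappa> (fst ` ?V)" by (rule inj_on_subset[OF \<kappa>_inj fst_V])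
      show "(k, l) \<in> ?V" if "(i, l) \<in> ?V" "(k, l') \<in> ?V" "\<kappa> i < \<kappa> k" for i k l l'
        using \<kappa>_le[OF that(3)] that(1,2) unfolding V by auto
    qed (use V in auto)
    have "1 \<le> j" using assms(2) V by blast
    then show "(c, j) \<in> ?V" "(c, Suc j) \<notin> ?V" using V c hc by auto
    show "\<kappa> c \<le> \<kappa> k" for k by (simp add: \<kappa>_def)
    show "c = 1 \<or> c = m" by (simp add: c_def)
  qed (use stack in auto)
  have "P\<^sub>1 = delete_cells_at (c, j) P" using assms(5) hc by (cases "i = 1") (simp_all add: c_def)
  then have P1: "P\<^sub>1 = P - {corner_cell}" by (simp add: delete_cells_at_corner)
  have P2: "P\<^sub>2 = cells_above" unfolding assms(6) delete_cells_below_def cells_above_def by auto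
  show ?thesis unfolding P1 P2 by (rule multiplicity_recursion)
qed

end
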